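(* Let $\varphi:M^m\to\mathbb{S}^n$ be a proper biharmonic submanifold, not necessarily compact, in the unit Euclidean sphere $\mathbb{S}^n$, with mean curvature $f$. Denote by $\phi=\mathbf{i}\circ\varphi:M\to\mathbb{R}^{n+1}$ the inclusion of $M$ in $\mathbb{R}^{n+1}$, where $\mathbf{i}:\mathbb{S}^n\to\mathbb{R}^{n+1}$ is the canonical inclusion map. Then: (i) $M$ is a $1$-type submanifold of $\mathbb{R}^{n+1}$ if and only if $f=1$ on $M$. In this case, $\phi=\phi_0+\phi_p$, with $\Delta\phi_p=2m\phi_p$ and $\phi_0\in\mathbb{R}^{n+1}$ a constant vector with $|\phi_0|=1/\sqrt 2$. (ii) $M$ is a $2$-type submanifold if and only if $f$ is constant and $f\in(0,1)$. In this case, $\phi=\phi_p+\phi_q$, with $\Delta\phi_p=m(1-f)\phi_p$ and $\Delta\phi_q=m(1+f)\phi_q$.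
   Context: All manifolds are smooth and connected. Let $\varphi:M^m\to N$ be the inclusion of an $m$-dimensional submanifold in a Riemannian manifold $N$, with mean curvature vector field $H$ (so $mH$ is the trace of the second fundamental form) and mean curvature $f=|H|$ (here computed in $N=\mathbb{S}^n$). $M$ is biharmonic if $\Delta H+\operatorname{trace}R^N(d\varphi(\cdot),H)d\varphi(\cdot)=0$, where $\Delta V=-\operatorname{trace}\nabla^2V$ is the rough Laplacian on sections of $\varphi^{-1}(TN)$ and $R^N(X,Y)=[\nabla_X,\nabla_Y]-\nabla_{[X,Y]}$; it is proper biharmonic if it is biharmonic and not minimal ($H\not\equiv0$). On functions $\Delta$ is the Laplacian of $M$ with the sign $\Delta=-\operatorname{trace}\nabla d$, acting componentwise on $\mathbb{R}^{n+1}$-valued maps. Finite type: a submanifold $M\subset\mathbb{R}^{n+1}$ with inclusion $\phi$ is of $k$-type if $\phi=\phi_0+\phi_{t_1}+\dots+\phi_{t_k}$, where $\phi_0\in\mathbb{R}^{n+1}$ is a constant vector, the $\phi_{t_i}:M\to\mathbb{R}^{n+1}$ are non-constant maps with $\Delta\phi_{t_i}=\lambda_{t_i}\phi_{t_i}$, and the real numbers $\lambda_{t_1},\dots,\lambda_{t_k}$ are mutually distinct. A submanifold of $\mathbb{S}^n$ is of $k$-type if it is so as a submanifold of $\mathbb{R}^{n+1}$. *)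

theory Defs
  imports "HOL-Analysis.Analysis"
begin

section \<open>Smooth maps on open subsets of Euclidean space\<close>

definition pd :: "'m \<Rightarrow> (real^'m \<Rightarrow> 'b::real_normed_vector) \<Rightarrow> real^'m \<Rightarrow> 'b" where
  "pd i F u = frechet_derivative F (at u) (axis i 1)"

fun iter_pd :: "'m list \<Rightarrow> (real^'m \<Rightarrow> 'b::real_normed_vector) \<Rightarrow> real^'m \<Rightarrow> 'b" where
  "iter_pd [] F = F"
| "iter_pd (i # is) F = pd i (iter_pd is F)"

text \<open>Class \<open>C\<^sup>\<infinity>\<close>: iterated partial derivatives of all orders exist and are (Frechet) differentiable,
  hence continuous. Meant for open \<open>U\<close>.\<close>

definition smooth_on :: "(real^'m) set \<Rightarrow> (real^'m \<Rightarrow> 'b::real_normed_vector) \<Rightarrow> bool" where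
  "smooth_on U F \<longleftrightarrow> (\<forall>is. \<forall>u\<in>U. iter_pd is F differentiable (at u))"


section \<open>Submanifolds of the unit sphere\<close>

text \<open>An \<open>m\<close>-dimensional submanifold of \<open>\<real>\<^sup>n\<^sup>+\<^sup>1\<close>, \<open>m = CARD('m)\<close>, \<open>n + 1 = CARD('n)\<close>, is a set of points
  of \<open>\<real>\<^sup>n\<^sup>+\<^sup>1\<close> with a smooth structure of its own for which the inclusion is an immersion. The
  structure is a set of local parametrizations \<open>(U, x)\<close> with \<open>U\<close> open in \<open>\<real>\<^sup>m\<close> and \<open>x\<close> mapping \<open>U\<close>
  injectively onto an open piece of the submanifold. The inclusion \<open>\<phi>\<close> is the identity on points; in
  the coordinates given by \<open>(U, x)\<close> it is the map \<open>x\<close> itself.\<close>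

type_synonym ('m, 'n) atlas = "((real^'m) set \<times> (real^'m \<Rightarrow> real^'n)) set"

definition points :: "('m, 'n) atlas \<Rightarrow> (real^'n) set" where
  "points M = (\<Union>(U, x)\<in>M. x ` U)"

text \<open>The manifold topology; it may be finer than the subspace topology (equal to it exactly for
  embedded submanifolds).\<close>

definition atlas_topology :: "('m::finite, 'n::finite) atlas \<Rightarrow> (real^'n) topology" where
  "atlas_topology M =
     topology (\<lambda>S. S \<subseteq> points M \<and> (\<forall>(U, x)\<in>M. open U \<longrightarrow> open {u\<in>U. x u \<in> S}))"

lemma openin_atlas_topology:
  fixes M :: "('m::finite, 'n::finite) atlas"
  shows "openin (atlas_topology M) S \<longleftrightarrow>
     S \<subseteq> points M \<and> (\<forall>(U, x)\<in>M. open U \<longrightarrow> open {u\<in>U. x u \<in> S})"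
proof -
  let ?P = "\<lambda>S. S \<subseteq> points M \<and> (\<forall>(U, x)\<in>M. open U \<longrightarrow> open {u\<in>U. x u \<in> S})"
  have "istopology ?P"
    unfolding istopology_def
  proof (intro conjI allI impI)
    fix S T assume "?P S" "?P T"
    moreover have "{u\<in>U. x u \<in> S \<inter> T} = {u\<in>U. x u \<in> S} \<inter> {u\<in>U. x u \<in> T}"
      for U and x :: "real^'m \<Rightarrow> real^'n"
      by auto
    ultimately show "S \<inter> T \<subseteq> points M"
      and "\<forall>(U, x)\<in>M. open U \<longrightarrow> open {u\<in>U. x u \<in> S \<inter> T}"
      by (auto intro: open_Int)
  next
    fix K assume K: "\<forall>S\<in>K. ?P S"
    have "{u\<in>U. x u \<in> \<Union>K} = (\<Union>S\<in>K. {u\<in>U. x u \<in> S})"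
      for U and x :: "real^'m \<Rightarrow> real^'n"
      by auto
    with K show "\<forall>(U, x)\<in>M. open U \<longrightarrow> open {u\<in>U. x u \<in> \<Union>K}"
      by (auto intro!: open_UN)
    from K show "\<Union>K \<subseteq> points M"
      by blast
  qed
  then show ?thesis
    by (simp add: atlas_topology_def)
qed

definition second_countable_space :: "'a topology \<Rightarrow> bool" where
  "second_countable_space T \<longleftrightarrow>
     (\<exists>B. countable B \<and> (\<forall>S\<in>B. openin T S) \<and>
          (\<forall>S p. openin T S \<and> p \<in> S \<longrightarrow> (\<exists>V\<in>B. p \<in> V \<and> V \<subseteq> S)))"

definition submanifold :: "('m::finite, 'n::finite) atlas \<Rightarrow> bool" where
  "submanifold M \<longleftrightarrow>
     (\<forall>(U, x)\<in>M. open U \<and> inj_on x U \<and> smooth_on U x \<and>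
                  (\<forall>u\<in>U. inj (frechet_derivative x (at u)))) \<and>
     (\<forall>(U, x)\<in>M. \<forall>(V, y)\<in>M. open {u\<in>U. x u \<in> y ` V} \<and>
                               smooth_on {u\<in>U. x u \<in> y ` V} (inv_into V y \<circ> x)) \<and>
     Hausdorff_space (atlas_topology M) \<and> second_countable_space (atlas_topology M)"

definition connected_sphere_submanifold :: "('m::finite, 'n::finite) atlas \<Rightarrow> bool" where
  "connected_sphere_submanifold M \<longleftrightarrow>
     submanifold M \<and> connected_space (atlas_topology M) \<and> points M \<subseteq> sphere 0 1"

definition smooth_map :: "('m::finite, 'n::finite) atlas \<Rightarrow> (real^'n \<Rightarrow> 'b::real_normed_vector) \<Rightarrow> bool" where
  "smooth_map M F \<longleftrightarrow> (\<forall>(U, x)\<in>M. smooth_on U (F \<circ> x))"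

text \<open>Tensorial quantities at a point \<open>p\<close> are computed in an arbitrarily chosen parametrization
  around \<open>p\<close>; all the quantities for which this is used below are independent of the choice.\<close>

definition chart_at :: "('m, 'n) atlas \<Rightarrow> real^'n \<Rightarrow> (real^'m) set \<times> (real^'m \<Rightarrow> real^'n)" where
  "chart_at M p = (SOME (U, x). (U, x) \<in> M \<and> p \<in> x ` U)"

definition param_at :: "('m, 'n) atlas \<Rightarrow> real^'n \<Rightarrow> real^'m \<Rightarrow> real^'n" where
  "param_at M p = snd (chart_at M p)"

definition coord_at :: "('m, 'n) atlas \<Rightarrow> real^'n \<Rightarrow> real^'m" where
  "coord_at M p = inv_into (fst (chart_at M p)) (param_at M p) p"


section \<open>The induced metric and its Levi-Civita connection\<close>

definition metric :: "(real^'m \<Rightarrow> real^'n) \<Rightarrow> real^'m \<Rightarrow> real^'m^'m" where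
  "metric x u = (\<chi> i j. pd i x u \<bullet> pd j x u)"

definition cometric :: "(real^'m \<Rightarrow> real^'n) \<Rightarrow> real^'m \<Rightarrow> real^'m^'m" where
  "cometric x u = matrix_inv (metric x u)"

text \<open>\<open>christoffel x u k i j\<close> is \<open>\<Gamma>\<^sup>k\<^sub>i\<^sub>j\<close>.\<close>

definition christoffel :: "(real^'m \<Rightarrow> real^'n) \<Rightarrow> real^'m \<Rightarrow> 'm \<Rightarrow> 'm \<Rightarrow> 'm \<Rightarrow> real" where
  "christoffel x u k i j =
     (1 / 2) * (\<Sum>l\<in>UNIV. cometric x u $ k $ l *
       (pd i (\<lambda>w. metric x w $ j $ l) u + pd j (\<lambda>w. metric x w $ i $ l) u
        - pd l (\<lambda>w. metric x w $ i $ j) u))"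

definition metric_trace ::
    "(real^'m \<Rightarrow> real^'n) \<Rightarrow> real^'m \<Rightarrow> ('m \<Rightarrow> 'm \<Rightarrow> 'b::real_vector) \<Rightarrow> 'b" where
  "metric_trace x u T = (\<Sum>i\<in>UNIV. \<Sum>j\<in>UNIV. (cometric x u $ i $ j) *\<^sub>R T i j)"

definition hessian :: "(real^'m \<Rightarrow> real^'n) \<Rightarrow> (real^'m \<Rightarrow> real) \<Rightarrow> real^'m \<Rightarrow> 'm \<Rightarrow> 'm \<Rightarrow> real" where
  "hessian x h u i j = pd i (pd j h) u - (\<Sum>k\<in>UNIV. christoffel x u k i j * pd k h u)"

definition laplacian :: "('m::finite, 'n::finite) atlas \<Rightarrow> (real^'n \<Rightarrow> real) \<Rightarrow> real^'n \<Rightarrow> real" where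
  "laplacian M h p =
     (let x = param_at M p; u = coord_at M p in - metric_trace x u (hessian x (h \<circ> x) u))"

definition vec_laplacian ::
    "('m::finite, 'n::finite) atlas \<Rightarrow> (real^'n \<Rightarrow> real^'n) \<Rightarrow> real^'n \<Rightarrow> real^'n" where
  "vec_laplacian M F p = (\<chi> a. laplacian M (\<lambda>q. F q $ a) p)"


section \<open>The Levi-Civita connection and the curvature of the unit sphere\<close>

definition sphere_proj :: "real^'n \<Rightarrow> real^'n \<Rightarrow> real^'n" where
  "sphere_proj p v = v - (v \<bullet> p) *\<^sub>R p"

text \<open>A vector field on the sphere is a map \<open>Z\<close> of which only the values at unit vectors matter. It is
  differentiated through its extension that is constant along rays; on tangent directions this is the
  derivative of \<open>Z\<close> along the sphere.\<close>

definition radial_ext :: "(real^'n \<Rightarrow> real^'n) \<Rightarrow> real^'n \<Rightarrow> real^'n" where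
  "radial_ext Z z = Z (z /\<^sub>R norm z)"

definition sphere_field :: "(real^'n::finite \<Rightarrow> real^'n) \<Rightarrow> bool" where
  "sphere_field Z \<longleftrightarrow> smooth_on (- {0}) (radial_ext Z) \<and> (\<forall>p\<in>sphere 0 1. Z p \<bullet> p = 0)"

definition sphere_deriv :: "(real^'n \<Rightarrow> real^'n) \<Rightarrow> (real^'n \<Rightarrow> real^'n) \<Rightarrow> real^'n \<Rightarrow> real^'n" where
  "sphere_deriv X Z p = frechet_derivative (radial_ext Z) (at p) (X p)"

text \<open>The Levi-Civita connection of the sphere is the tangential part of the Euclidean derivative.\<close>

definition sphere_nabla :: "(real^'n \<Rightarrow> real^'n) \<Rightarrow> (real^'n \<Rightarrow> real^'n) \<Rightarrow> real^'n \<Rightarrow> real^'n" where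
  "sphere_nabla X Z p = sphere_proj p (sphere_deriv X Z p)"

definition sphere_bracket :: "(real^'n \<Rightarrow> real^'n) \<Rightarrow> (real^'n \<Rightarrow> real^'n) \<Rightarrow> real^'n \<Rightarrow> real^'n" where
  "sphere_bracket X Y p = sphere_deriv X Y p - sphere_deriv Y X p"

text \<open>\<open>R(v,w)z\<close> at \<open>p\<close> for tangent vectors: the common value of
  \<open>\<nabla>\<^sub>X\<nabla>\<^sub>YZ - \<nabla>\<^sub>Y\<nabla>\<^sub>XZ - \<nabla>\<^bsub>[X,Y]\<^esub>Z\<close> over all fields extending \<open>v\<close>, \<open>w\<close>, \<open>z\<close>.\<close>

definition sphere_curvature ::
    "real^'n::finite \<Rightarrow> real^'n \<Rightarrow> real^'n \<Rightarrow> real^'n \<Rightarrow> real^'n" where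
  "sphere_curvature p v w z =
     (THE r. \<forall>X Y Z. sphere_field X \<and> sphere_field Y \<and> sphere_field Z \<and>
                      X p = v \<and> Y p = w \<and> Z p = z \<longrightarrow>
        r = sphere_nabla X (sphere_nabla Y Z) p - sphere_nabla Y (sphere_nabla X Z) p
            - sphere_nabla (sphere_bracket X Y) Z p)"


section \<open>Mean curvature and biharmonicity in the unit sphere\<close>

text \<open>The connection of the pull-back bundle \<open>\<phi>\<^sup>-\<^sup>1(TS\<^sup>n)\<close>, in coordinates; sections are maps into
  \<open>\<real>\<^sup>n\<^sup>+\<^sup>1\<close> that are tangent to the sphere.\<close>

definition pullback_nabla ::
    "(real^'m \<Rightarrow> real^'n) \<Rightarrow> 'm \<Rightarrow> (real^'m \<Rightarrow> real^'n) \<Rightarrow> real^'m \<Rightarrow> real^'n" where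
  "pullback_nabla x i V u = sphere_proj (x u) (pd i V u)"

definition pullback_nabla2 ::
    "(real^'m \<Rightarrow> real^'n) \<Rightarrow> (real^'m \<Rightarrow> real^'n) \<Rightarrow> real^'m \<Rightarrow> 'm \<Rightarrow> 'm \<Rightarrow> real^'n" where
  "pullback_nabla2 x V u i j =
     pullback_nabla x i (pullback_nabla x j V) u
     - (\<Sum>k\<in>UNIV. christoffel x u k i j *\<^sub>R pullback_nabla x k V u)"

definition second_fundamental_form ::
    "(real^'m \<Rightarrow> real^'n) \<Rightarrow> real^'m \<Rightarrow> 'm \<Rightarrow> 'm \<Rightarrow> real^'n" where
  "second_fundamental_form x u i j =
     pullback_nabla x i (pd j x) u - (\<Sum>k\<in>UNIV. christoffel x u k i j *\<^sub>R pd k x u)"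

definition mean_curvature_vector :: "('m::finite, 'n::finite) atlas \<Rightarrow> real^'n \<Rightarrow> real^'n" where
  "mean_curvature_vector M p =
     (let x = param_at M p; u = coord_at M p
      in (1 / real CARD('m)) *\<^sub>R metric_trace x u (second_fundamental_form x u))"

definition mean_curvature :: "('m::finite, 'n::finite) atlas \<Rightarrow> real^'n \<Rightarrow> real" where
  "mean_curvature M p = norm (mean_curvature_vector M p)"

definition rough_laplacian ::
    "('m::finite, 'n::finite) atlas \<Rightarrow> (real^'n \<Rightarrow> real^'n) \<Rightarrow> real^'n \<Rightarrow> real^'n" where
  "rough_laplacian M V p =
     (let x = param_at M p; u = coord_at M p in - metric_trace x u (pullback_nabla2 x (V \<circ> x) u))"

text \<open>\<open>trace R(d\<phi>(\<cdot>), V) d\<phi>(\<cdot>)\<close>\<close>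

definition curvature_trace ::
    "('m::finite, 'n::finite) atlas \<Rightarrow> (real^'n \<Rightarrow> real^'n) \<Rightarrow> real^'n \<Rightarrow> real^'n" where
  "curvature_trace M V p =
     (let x = param_at M p; u = coord_at M p
      in metric_trace x u (\<lambda>i j. sphere_curvature p (pd i x u) (V p) (pd j x u)))"

definition biharmonic :: "('m::finite, 'n::finite) atlas \<Rightarrow> bool" where
  "biharmonic M \<longleftrightarrow>
     (\<forall>p\<in>points M. rough_laplacian M (mean_curvature_vector M) p
                     + curvature_trace M (mean_curvature_vector M) p = 0)"

definition minimal :: "('m::finite, 'n::finite) atlas \<Rightarrow> bool" where
  "minimal M \<longleftrightarrow> (\<forall>p\<in>points M. mean_curvature_vector M p = 0)"

definition proper_biharmonic :: "('m::finite, 'n::finite) atlas \<Rightarrow> bool" where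
  "proper_biharmonic M \<longleftrightarrow> biharmonic M \<and> \<not> minimal M"


section \<open>Submanifolds of finite type\<close>

definition eigenmap :: "('m::finite, 'n::finite) atlas \<Rightarrow> real \<Rightarrow> (real^'n \<Rightarrow> real^'n) \<Rightarrow> bool" where
  "eigenmap M l F \<longleftrightarrow>
     smooth_map M F \<and> \<not> F constant_on points M \<and>
     (\<forall>p\<in>points M. vec_laplacian M F p = l *\<^sub>R F p)"

definition finite_type :: "nat \<Rightarrow> ('m::finite, 'n::finite) atlas \<Rightarrow> bool" where
  "finite_type k M \<longleftrightarrow>
     (\<exists>c F l. inj_on l {..<k} \<and> (\<forall>t<k. eigenmap M (l t) (F t)) \<and>
              (\<forall>p\<in>points M. p = c + (\<Sum>t<k. F t p)))"

end

theory Submission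
  imports Defs
begin

text \<open>Write \<open>p\<close> for the position vector, \<open>H\<close> for the mean curvature vector in the sphere and \<open>f = |H|\<close>.
  In any submanifold of the sphere \<open>\<Delta> p = m (p - H)\<close>. Since trace \<open>R(\<cdot>, H)\<cdot> = - m H\<close>, biharmonicity is
  \<open>\<Delta> H = m (H - f\<^sup>2 p)\<close> for the componentwise Laplacian, so for constant \<open>f\<close> the span of \<open>p\<close> and \<open>H\<close> is
  invariant under \<open>\<Delta>\<close>, with eigenvectors \<open>p + H / f\<close> and \<open>p - H / f\<close>. Conversely, finite type imposes a
  linear relation between \<open>p\<close>, \<open>H\<close> and a constant vector, whose radial and tangential parts make \<open>f\<close>
  constant. A map \<open>F\<close> of constant norm satisfies \<open>F \<bullet> \<Delta> F = |dF|\<^sup>2\<close>; for \<open>F = p + H\<close> this reads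
  \<open>m (1 - f\<^sup>2) = |dF|\<^sup>2\<close>, hence \<open>f \<le> 1\<close>, and \<open>p + H\<close> is a constant vector when \<open>f = 1\<close>. This replaces any
  appeal to compactness.\<close>

section \<open>Partial derivatives\<close>

text \<open>Quantities at a point are computed in a chart chosen anew for that point. A Laplacian is
  only evaluated pointwise, so the chosen chart suffices for it; \<open>H\<close> is differentiated
  along charts, so its smoothness and its independence of the chart have to be proved. If
  \<open>f\<close> has the constant value \<open>c\<close>, then on the span of \<open>p\<close> and
  \<open>H\<close> the operator \<open>\<Delta> / m - 1\<close> sends \<open>p\<close> to
  \<open>- H\<close> and \<open>H\<close> to \<open>- c^2 p\<close>; its square is
  \<open>c^2\<close>, whence the eigenvalues \<open>m (1 - c)\<close> and \<open>m (1 + c)\<close>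
  of \<open>\<Delta>\<close>. At \<open>c = 1\<close> the first of them is 0 and its part of
  \<open>p\<close> is constant, so two parts collapse to one. As \<open>M\<close> need not be
  compact, nonconstant harmonic parts cannot be excluded in advance; hence for \<open>f = 1\<close>
  a decomposition with eigenvalue 0 is refuted by an argument of its own. The curvature of the
  sphere is a definite description over vector fields: evaluating it takes fields that extend given
  vectors and the symmetry of second derivatives, which shapes the calculus at the start.\<close>

lemma pd_has_derivative: "(f has_derivative D) (at u) \<Longrightarrow> pd i f u = D (axis i 1)"
  unfolding pd_def by (simp add: frechet_derivative_at [symmetric])

lemma frechet_derivative_eq_sum_pd:
  fixes f :: "real^'m \<Rightarrow> 'b::real_normed_vector"
  assumes "f differentiable at u"
  shows "frechet_derivative f (at u) h = (\<Sum>i\<in>UNIV. h $ i *\<^sub>R pd i f u)"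
proof -
  let ?D = "frechet_derivative f (at u)"
  have lin: "linear ?D"
    using assms by (rule linear_frechet_derivative)
  have "h = (\<Sum>i\<in>UNIV. h $ i *\<^sub>R axis i 1)"
    using basis_expansion [of h] by (simp add: scalar_mult_eq_scaleR)
  then have "?D h = ?D (\<Sum>i\<in>UNIV. h $ i *\<^sub>R axis i 1)"
    by simp
  also have "\<dots> = (\<Sum>i\<in>UNIV. h $ i *\<^sub>R ?D (axis i 1))"
    by (simp add: linear_sum [OF lin] linear_scale [OF lin])
  finally show ?thesis
    by (simp add: pd_def)
qed

lemma has_derivative_pd:
  fixes f :: "real^'m \<Rightarrow> 'b::real_normed_vector"
  assumes "f differentiable at u"
  shows "(f has_derivative (\<lambda>h. \<Sum>i\<in>UNIV. h $ i *\<^sub>R pd i f u)) (at u)"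
  using assms frechet_derivative_eq_sum_pd [OF assms] frechet_derivative_works
  by (metis (no_types, lifting) ext)

text \<open>No differentiability is assumed: both maps have the same derivatives at
  \<open>u\<close>, so even the arbitrary value of \<open>frechet_derivative\<close> at a point
  without derivative agrees.\<close>

lemma pd_cong:
  assumes "open U" "u \<in> U" "\<And>w. w \<in> U \<Longrightarrow> f w = g w"
  shows "pd i f u = pd i g u"
proof -
  have "(f has_derivative D) (at u) \<longleftrightarrow> (g has_derivative D) (at u)" for D
    using assms by (metis has_derivative_transform_within_open)
  then show ?thesis
    by (simp add: pd_def frechet_derivative_def)
qed

lemma differentiable_cong:
  assumes "open U" "u \<in> U" "\<And>w. w \<in> U \<Longrightarrow> f w = g w"
  shows "f differentiable at u \<longleftrightarrow> g differentiable at u"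
  using assms unfolding differentiable_def by (metis has_derivative_transform_within_open)

lemma pd_const [simp]: "pd i (\<lambda>w. c) u = 0"
  by (simp add: pd_def)

lemma pd_add:
  "f differentiable at u \<Longrightarrow> g differentiable at u \<Longrightarrow> pd i (\<lambda>w. f w + g w) u = pd i f u + pd i g u"
  by (subst pd_has_derivative [OF has_derivative_add [OF has_derivative_pd has_derivative_pd]])
     (auto simp: axis_def if_distrib if_distribR sum.If_cases cong: if_cong)

lemma pd_sum:
  assumes "\<And>a. a \<in> A \<Longrightarrow> f a differentiable at u"
  shows "pd i (\<lambda>w. \<Sum>a\<in>A. f a w) u = (\<Sum>a\<in>A. pd i (f a) u)"
  by (subst pd_has_derivative [OF has_derivative_sum [where f' = "\<lambda>a. frechet_derivative (f a) (at u)"]])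
     (use assms frechet_derivative_works in \<open>auto simp: pd_def\<close>)

lemma pd_bounded_linear:
  assumes "bounded_linear L" "f differentiable at u"
  shows "pd i (\<lambda>w. L (f w)) u = L (pd i f u)"
  by (subst pd_has_derivative [OF bounded_linear.has_derivative [OF assms(1)
        assms(2) [unfolded frechet_derivative_works]]]) (simp add: pd_def)

lemma pd_bilinear:
  assumes "bounded_bilinear prd" "f differentiable at u" "g differentiable at u"
  shows "pd i (\<lambda>w. prd (f w) (g w)) u = prd (pd i f u) (g u) + prd (f u) (pd i g u)"
  by (subst pd_has_derivative [OF bounded_bilinear.FDERIV [OF assms(1)
        assms(2,3) [unfolded frechet_derivative_works]]]) (simp add: pd_def)

lemmas pd_inner = pd_bilinear [OF bounded_bilinear_inner]
lemmas pd_scaleR = pd_bilinear [OF bounded_bilinear_scaleR]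

lemma differentiable_bilinear:
  assumes "bounded_bilinear prd" "f differentiable at u" "g differentiable at u"
  shows "(\<lambda>w. prd (f w) (g w)) differentiable at u"
  using assms bounded_bilinear.FDERIV unfolding differentiable_def by blast

lemma differentiable_bounded_linear:
  assumes "bounded_linear L" "f differentiable at u"
  shows "(\<lambda>w. L (f w)) differentiable at u"
  using assms bounded_linear.has_derivative unfolding differentiable_def by blast

lemma pd_inverse:
  fixes f :: "real^'m \<Rightarrow> real"
  assumes "f differentiable at u" "f u \<noteq> 0"
  shows "pd i (\<lambda>w. inverse (f w)) u = - (inverse (f u) * inverse (f u) * pd i f u)"
  by (subst pd_has_derivative [OF Deriv.has_derivative_inverse [OF assms(2)
        assms(1) [unfolded frechet_derivative_works]]]) (simp add: pd_def)

lemma pd_chain: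
  fixes f :: "real^'m \<Rightarrow> 'b::real_normed_vector" and g :: "real^'k \<Rightarrow> real^'m"
  assumes "g differentiable at u" "f differentiable at (g u)"
  shows "pd i (\<lambda>w. f (g w)) u = (\<Sum>a\<in>UNIV. pd i g u $ a *\<^sub>R pd a f (g u))"
proof -
  have "pd i (f \<circ> g) u = frechet_derivative f (at (g u)) (pd i g u)"
    by (simp add: pd_def frechet_derivative_compose [OF assms])
  then show ?thesis
    by (simp add: comp_def frechet_derivative_eq_sum_pd [OF assms(2)])
qed

text \<open>The mean value theorem is applied twice, along \<open>axis i 1\<close> to a difference
  of \<open>f\<close> and then along \<open>axis j 1\<close> to \<open>pd i f\<close>. The second
  difference is symmetric in \<open>i\<close> and \<open>j\<close>, which will force the mixed
  partial derivatives to agree.\<close>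

lemma mixed_difference_mean_value:
  fixes f :: "real^'m \<Rightarrow> real"
  assumes t: "0 < t" "2 * t < r" and ball: "ball u r \<subseteq> U"
    and f: "\<And>w. w \<in> U \<Longrightarrow> f differentiable at w"
    and fi: "\<And>w. w \<in> U \<Longrightarrow> pd i f differentiable at w"
  shows "\<exists>w. dist w u < 2 * t \<and>
    f (u + t *\<^sub>R axis i 1 + t *\<^sub>R axis j 1) - f (u + t *\<^sub>R axis i 1) - f (u + t *\<^sub>R axis j 1) + f u
      = t * t * pd j (pd i f) w"
proof -
  let ?e = "axis i 1 :: real^'m" and ?e' = "axis j 1 :: real^'m"
  have near: "dist (u + a *\<^sub>R ?e + b *\<^sub>R ?e') u \<le> a + b" if "0 \<le> a" "0 \<le> b" for a b
    using norm_triangle_ineq [of "a *\<^sub>R ?e" "b *\<^sub>R ?e'"] that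
    by (simp add: dist_norm algebra_simps)
  have U: "u + a *\<^sub>R ?e + b *\<^sub>R ?e' \<in> U" if "0 \<le> a" "a \<le> t" "0 \<le> b" "b \<le> t" for a b
  proof -
    have "dist (u + a *\<^sub>R ?e + b *\<^sub>R ?e') u < r"
      using near [of a b] that t by linarith
    then show ?thesis
      using ball by (auto simp: dist_commute)
  qed
  have line: "((\<lambda>s. h (p + s *\<^sub>R axis k 1)) has_real_derivative pd k h (p + s *\<^sub>R axis k 1)) (at s)"
    if "h differentiable at (p + s *\<^sub>R axis k 1)" for h :: "real^'m \<Rightarrow> real" and p k s
  proof -
    have "((\<lambda>s. p + s *\<^sub>R axis k 1) has_derivative (\<lambda>s. s *\<^sub>R axis k 1)) (at s)"
      by (auto intro!: derivative_eq_intros)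
    then have "((\<lambda>s. h (p + s *\<^sub>R axis k 1)) has_derivative
        (\<lambda>a. frechet_derivative h (at (p + s *\<^sub>R axis k 1)) (a *\<^sub>R axis k 1))) (at s)"
      by (rule has_derivative_compose) (use that in \<open>simp add: frechet_derivative_works\<close>)
    moreover have "frechet_derivative h (at (p + s *\<^sub>R axis k 1)) (a *\<^sub>R axis k 1) =
        pd k h (p + s *\<^sub>R axis k 1) * a" for a
      using linear_scale [OF linear_frechet_derivative [OF that]] by (simp add: pd_def)
    ultimately show ?thesis
      by (simp add: has_field_derivative_def)
  qed
  define g where "g s = f (u + s *\<^sub>R ?e + t *\<^sub>R ?e') - f (u + s *\<^sub>R ?e)" for s
  have dg: "(g has_real_derivative
      pd i f (u + s *\<^sub>R ?e + t *\<^sub>R ?e') - pd i f (u + s *\<^sub>R ?e)) (at s)"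
    if "0 \<le> s" "s \<le> t" for s
    unfolding g_def
    using line [where h = f and p = "u + t *\<^sub>R ?e'" and s = s and k = i]
      line [where h = f and p = u and s = s and k = i]
      f [OF U [of s t]] f [OF U [of s 0]] that t
    by (auto intro!: DERIV_diff simp: add_ac)
  obtain \<xi> where \<xi>: "0 < \<xi>" "\<xi> < t"
    "g t - g 0 = (t - 0) * (pd i f (u + \<xi> *\<^sub>R ?e + t *\<^sub>R ?e') - pd i f (u + \<xi> *\<^sub>R ?e))"
    using MVT2 [OF t(1) dg] by blast
  have dh: "((\<lambda>s. pd i f (u + \<xi> *\<^sub>R ?e + s *\<^sub>R ?e')) has_real_derivative
      pd j (pd i f) (u + \<xi> *\<^sub>R ?e + s *\<^sub>R ?e')) (at s)" if "0 \<le> s" "s \<le> t" for s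
    using line [where h = "pd i f" and p = "u + \<xi> *\<^sub>R ?e" and s = s and k = j] fi [OF U [of \<xi> s]] \<xi> that
    by auto
  obtain \<eta> where \<eta>: "0 < \<eta>" "\<eta> < t"
    "pd i f (u + \<xi> *\<^sub>R ?e + t *\<^sub>R ?e') - pd i f (u + \<xi> *\<^sub>R ?e + 0 *\<^sub>R ?e') =
      (t - 0) * pd j (pd i f) (u + \<xi> *\<^sub>R ?e + \<eta> *\<^sub>R ?e')"
    using MVT2 [OF t(1) dh] by blast
  have "dist (u + \<xi> *\<^sub>R ?e + \<eta> *\<^sub>R ?e') u < 2 * t"
    using near [of \<xi> \<eta>] \<xi> \<eta> by linarith
  then show ?thesis
    using \<xi>(3) \<eta>(3) by (intro exI [of _ "u + \<xi> *\<^sub>R ?e + \<eta> *\<^sub>R ?e'"]) (simp add: g_def)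
qed

text \<open>Reading the same second difference in both orders gives equal values of the two mixed
  derivatives at points arbitrarily close to \<open>u\<close>; continuity at \<open>u\<close> does
  the rest.\<close>

lemma pd_commute_real:
  fixes f :: "real^'m \<Rightarrow> real"
  assumes "open U" "u \<in> U" and f: "\<And>w. w \<in> U \<Longrightarrow> f differentiable at w"
    and f1: "\<And>w k. w \<in> U \<Longrightarrow> pd k f differentiable at w"
    and f2: "pd i (pd j f) differentiable at u" "pd j (pd i f) differentiable at u"
  shows "pd i (pd j f) u = pd j (pd i f) u"
proof (rule ccontr)
  assume "pd i (pd j f) u \<noteq> pd j (pd i f) u"
  \<comment> \<open>Half the gap, so that the \<open>e\<close>-neighbourhoods of the two values are
    disjoint.\<close>
  define e where "e = \<bar>pd i (pd j f) u - pd j (pd i f) u\<bar> / 2"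
  have e: "e > 0"
    using \<open>_ \<noteq> _\<close> by (simp add: e_def)
  obtain r where r: "r > 0" "ball u r \<subseteq> U"
    using assms by (meson open_contains_ball)
  have "isCont (pd i (pd j f)) u" "isCont (pd j (pd i f)) u"
    using f2 differentiable_imp_continuous_within by blast+
  then obtain d1 d2 where d: "d1 > 0" "d2 > 0"
    "\<And>w. dist w u < d1 \<Longrightarrow> \<bar>pd i (pd j f) w - pd i (pd j f) u\<bar> < e"
    "\<And>w. dist w u < d2 \<Longrightarrow> \<bar>pd j (pd i f) w - pd j (pd i f) u\<bar> < e"
    using e unfolding continuous_at_eps_delta dist_real_def by metis
  define t where "t = min r (min d1 d2) / 4"
  have t: "0 < t" "2 * t < r" "2 * t < d1" "2 * t < d2"
    using r d by (auto simp: t_def)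
  obtain v w where v: "dist v u < 2 * t" and w: "dist w u < 2 * t" and
    eqs: "f (u + t *\<^sub>R axis i 1 + t *\<^sub>R axis j 1) - f (u + t *\<^sub>R axis i 1) - f (u + t *\<^sub>R axis j 1) + f u
      = t * t * pd j (pd i f) v"
    "f (u + t *\<^sub>R axis j 1 + t *\<^sub>R axis i 1) - f (u + t *\<^sub>R axis j 1) - f (u + t *\<^sub>R axis i 1) + f u
      = t * t * pd i (pd j f) w"
    using mixed_difference_mean_value [of t r u U f i j, OF t(1,2) r(2) f f1]
      mixed_difference_mean_value [of t r u U f j i, OF t(1,2) r(2) f f1] by blast
  have "f (u + t *\<^sub>R axis j 1 + t *\<^sub>R axis i 1) = f (u + t *\<^sub>R axis i 1 + t *\<^sub>R axis j 1)"
    by (simp add: add_ac)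
  then have "t * t * pd j (pd i f) v = t * t * pd i (pd j f) w"
    using eqs by linarith
  then have "pd j (pd i f) v = pd i (pd j f) w"
    using t by simp
  with d(3) [of w] d(4) [of v] v w t show False
    unfolding e_def by (simp add: abs_if field_simps split: if_splits)
qed


section \<open>Smooth maps\<close>

text \<open>In contrast to \<open>iter_pd\<close>, the recursion differentiates the map itself
  first. Rules for sums, products and inverses can then be proved by induction on the order.\<close>

fun times_differentiable_on :: "nat \<Rightarrow> (real^'m) set \<Rightarrow> (real^'m \<Rightarrow> 'b::real_normed_vector) \<Rightarrow> bool" where
  "times_differentiable_on 0 U F \<longleftrightarrow> (\<forall>u\<in>U. F differentiable at u)"
| "times_differentiable_on (Suc n) U F \<longleftrightarrow>
     (\<forall>u\<in>U. F differentiable at u) \<and> (\<forall>i. times_differentiable_on n U (pd i F))"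

lemma times_differentiable_Suc_imp:
  "times_differentiable_on (Suc n) U F \<Longrightarrow> times_differentiable_on n U F"
  by (induction n arbitrary: F) auto

lemma iter_pd_append: "iter_pd (is @ js) F = iter_pd is (iter_pd js F)"
  by (induction "is") auto

lemma times_differentiable_on_iter_pd:
  "times_differentiable_on n U F \<longleftrightarrow>
     (\<forall>is. length is \<le> n \<longrightarrow> (\<forall>u\<in>U. iter_pd is F differentiable at u))"
proof (induction n arbitrary: F)
  case (Suc n)
  show ?case
  proof
    assume L: "times_differentiable_on (Suc n) U F"
    show "\<forall>is. length is \<le> Suc n \<longrightarrow> (\<forall>u\<in>U. iter_pd is F differentiable at u)"
    proof (intro allI impI)
      fix "is" :: "'a list" assume len: "length is \<le> Suc n"
      show "\<forall>u\<in>U. iter_pd is F differentiable at u"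
      \<comment> \<open>The last index of the list is the derivative taken first, so the list is
        split at its end.\<close>
      proof (cases "is" rule: rev_cases)
        case Nil
        then show ?thesis
          using L by auto
      next
        case (snoc js i)
        then show ?thesis
          using L len Suc.IH [of "pd i F"] by (auto simp: iter_pd_append)
      qed
    qed
  next
    assume R: "\<forall>is. length is \<le> Suc n \<longrightarrow> (\<forall>u\<in>U. iter_pd is F differentiable at u)"
    have "\<forall>u\<in>U. iter_pd is (pd i F) differentiable at u" if "length is \<le> n" for "is" i
      using R [rule_format, of "is @ [i]"] that by (auto simp: iter_pd_append)
    moreover have "\<forall>u\<in>U. F differentiable at u"
      using R [rule_format, of "[]"] by auto
    ultimately show "times_differentiable_on (Suc n) U F"
      using Suc.IH by auto
  qed
qed auto

lemma smooth_on_iff_times_differentiable: "smooth_on U F \<longleftrightarrow> (\<forall>n. times_differentiable_on n U F)"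
  unfolding smooth_on_def times_differentiable_on_iter_pd by blast

lemma smooth_on_imp_differentiable: "smooth_on U F \<Longrightarrow> u \<in> U \<Longrightarrow> F differentiable at u"
  unfolding smooth_on_def by (metis iter_pd.simps(1))

lemma smooth_on_pd: "smooth_on U F \<Longrightarrow> smooth_on U (pd i F)"
  unfolding smooth_on_iff_times_differentiable by (metis times_differentiable_on.simps(2))

lemma times_differentiable_on_cong:
  assumes "open U" "\<And>w. w \<in> U \<Longrightarrow> f w = g w"
  shows "times_differentiable_on n U f \<longleftrightarrow> times_differentiable_on n U g"
  using assms(2)
proof (induction n arbitrary: f g)
  case 0
  then show ?case
    using differentiable_cong [OF assms(1), of _ f g] by auto
next
  case (Suc n)
  have "times_differentiable_on n U (pd i f) \<longleftrightarrow> times_differentiable_on n U (pd i g)" for i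
    using pd_cong [OF assms(1)] Suc.prems by (intro Suc.IH) blast
  moreover have "f differentiable at w \<longleftrightarrow> g differentiable at w" if "w \<in> U" for w
    using differentiable_cong [OF assms(1) that, of f g] Suc.prems by blast
  ultimately show ?case
    by simp
qed

lemma smooth_on_cong:
  assumes "open U" "\<And>w. w \<in> U \<Longrightarrow> f w = g w"
  shows "smooth_on U f \<longleftrightarrow> smooth_on U g"
  using times_differentiable_on_cong [OF assms] by (simp add: smooth_on_iff_times_differentiable)

lemma times_differentiable_on_const: "times_differentiable_on n U (\<lambda>w. c)"
proof (induction n arbitrary: c)
  case (Suc n)
  then show ?case
    by (simp add: pd_const [THEN ext])
qed auto

lemma times_differentiable_on_add:
  assumes "open U" "times_differentiable_on n U f" "times_differentiable_on n U g"
  shows "times_differentiable_on n U (\<lambda>w. f w + g w)"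
  using assms(2,3)
proof (induction n arbitrary: f g)
  case (Suc n)
  have "times_differentiable_on n U (pd i (\<lambda>w. f w + g w))" for i
    using Suc.IH [of "pd i f" "pd i g"] Suc.prems pd_add [of f _ g i]
    by (subst times_differentiable_on_cong [OF assms(1), of _ "\<lambda>w. pd i f w + pd i g w"]) auto
  then show ?case
    using Suc.prems by auto
qed auto

lemma times_differentiable_on_bounded_linear:
  assumes "open U" "bounded_linear L" "times_differentiable_on n U f"
  shows "times_differentiable_on n U (\<lambda>w. L (f w))"
  using assms(3)
proof (induction n arbitrary: f)
  case 0
  then show ?case
    using differentiable_bounded_linear [OF assms(2)] by auto
next
  case (Suc n)
  have "times_differentiable_on n U (pd i (\<lambda>w. L (f w)))" for i
    using Suc.IH [of "pd i f"] Suc.prems pd_bounded_linear [OF assms(2), of f _ i]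
    by (subst times_differentiable_on_cong [OF assms(1), of _ "\<lambda>w. L (pd i f w)"]) auto
  then show ?case
    using Suc.prems differentiable_bounded_linear [OF assms(2)] by auto
qed

lemma times_differentiable_on_bilinear:
  assumes "open U" "bounded_bilinear prd" "times_differentiable_on n U f" "times_differentiable_on n U g"
  shows "times_differentiable_on n U (\<lambda>w. prd (f w) (g w))"
  using assms(3,4)
proof (induction n arbitrary: f g)
  case 0
  then show ?case
    by (simp add: differentiable_bilinear [OF assms(2)])
next
  case (Suc n)
  have "times_differentiable_on n U (pd i (\<lambda>w. prd (f w) (g w)))" for i
  proof -
    have "times_differentiable_on n U (\<lambda>w. prd (pd i f w) (g w))"
      "times_differentiable_on n U (\<lambda>w. prd (f w) (pd i g w))"
      using Suc times_differentiable_Suc_imp by (metis times_differentiable_on.simps(2))+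
    then show ?thesis
      using Suc.prems times_differentiable_on_add [OF assms(1)] pd_bilinear [OF assms(2), of f _ g i]
      by (subst times_differentiable_on_cong [OF assms(1), of _ "\<lambda>w. prd (pd i f w) (g w) + prd (f w) (pd i g w)"])
         auto
  qed
  then show ?case
    using Suc.prems by (simp add: differentiable_bilinear [OF assms(2)])
qed

text \<open>The derivative of \<open>1 / f\<close> contains \<open>1 / f\<close> again, but one
  order lower, so the induction hypothesis applies to the same \<open>f\<close>.\<close>

lemma times_differentiable_on_inverse:
  fixes f :: "real^'m \<Rightarrow> real"
  assumes "open U" "\<And>w. w \<in> U \<Longrightarrow> f w \<noteq> 0" "times_differentiable_on n U f"
  shows "times_differentiable_on n U (\<lambda>w. inverse (f w))"
  using assms(3)
proof (induction n)
  case 0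
  then show ?case
    by (simp add: differentiable_inverse assms(2))
next
  case (Suc n)
  have f: "times_differentiable_on n U (pd i f)" for i
    using Suc.prems by auto
  have inv: "times_differentiable_on n U (\<lambda>w. inverse (f w))"
    using Suc.IH Suc.prems times_differentiable_Suc_imp by blast
  have "times_differentiable_on n U (\<lambda>w. - (inverse (f w) * inverse (f w) * pd i f w))" for i
    by (intro times_differentiable_on_bounded_linear [OF assms(1) bounded_linear_minus [OF bounded_linear_ident]]
        times_differentiable_on_bilinear [OF assms(1) bounded_bilinear_mult] f inv)
  then have "times_differentiable_on n U (pd i (\<lambda>w. inverse (f w)))" for i
    using Suc.prems pd_inverse [of f _ i] assms(2)
    by (subst times_differentiable_on_cong [OF assms(1), of _ "\<lambda>w. - (inverse (f w) * inverse (f w) * pd i f w)"])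
       auto
  then show ?case
    using Suc.prems by (simp add: differentiable_inverse assms(2))
qed

context
  fixes U :: "(real^'m) set"
  assumes U: "open U"
begin

lemma smooth_on_const: "smooth_on U (\<lambda>w. c)"
  by (simp add: smooth_on_iff_times_differentiable times_differentiable_on_const)

lemma smooth_on_add: "smooth_on U f \<Longrightarrow> smooth_on U g \<Longrightarrow> smooth_on U (\<lambda>w. f w + g w)"
  using times_differentiable_on_add [OF U, where f = f and g = g]
  unfolding smooth_on_iff_times_differentiable by blast

lemma smooth_on_bounded_linear: "bounded_linear L \<Longrightarrow> smooth_on U f \<Longrightarrow> smooth_on U (\<lambda>w. L (f w))"
  using times_differentiable_on_bounded_linear [OF U, where L = L and f = f]
  unfolding smooth_on_iff_times_differentiable by blast

lemma smooth_on_bilinear: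
  "bounded_bilinear prd \<Longrightarrow> smooth_on U f \<Longrightarrow> smooth_on U g \<Longrightarrow> smooth_on U (\<lambda>w. prd (f w) (g w))"
  using times_differentiable_on_bilinear [OF U, where prd = prd and f = f and g = g]
  unfolding smooth_on_iff_times_differentiable by blast

lemma smooth_on_inverse:
  fixes f :: "real^'m \<Rightarrow> real"
  shows "smooth_on U f \<Longrightarrow> (\<And>w. w \<in> U \<Longrightarrow> f w \<noteq> 0) \<Longrightarrow> smooth_on U (\<lambda>w. inverse (f w))"
  using times_differentiable_on_inverse [OF U, where f = f]
  unfolding smooth_on_iff_times_differentiable by blast

lemma smooth_on_minus: "smooth_on U f \<Longrightarrow> smooth_on U (\<lambda>w. - f w)"
  by (rule smooth_on_bounded_linear [OF bounded_linear_minus [OF bounded_linear_ident]])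

lemma smooth_on_diff: "smooth_on U f \<Longrightarrow> smooth_on U g \<Longrightarrow> smooth_on U (\<lambda>w. f w - g w)"
  using smooth_on_add [of f "\<lambda>w. - g w"] smooth_on_minus [of g] by simp

lemma smooth_on_sum:
  "(\<And>a. a \<in> A \<Longrightarrow> smooth_on U (f a)) \<Longrightarrow> smooth_on U (\<lambda>w. \<Sum>a\<in>A. f a w)"
  by (induction A rule: infinite_finite_induct) (auto intro: smooth_on_add smooth_on_const)

lemma smooth_on_prod:
  fixes f :: "'k \<Rightarrow> real^'m \<Rightarrow> real"
  shows "(\<And>a. a \<in> A \<Longrightarrow> smooth_on U (f a)) \<Longrightarrow> smooth_on U (\<lambda>w. \<Prod>a\<in>A. f a w)"
  by (induction A rule: infinite_finite_induct)
     (auto intro: smooth_on_bilinear [OF bounded_bilinear_mult] smooth_on_const)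

lemma pd_commute:
  fixes f :: "real^'m \<Rightarrow> 'b::real_inner"
  assumes f: "smooth_on U f" and u: "u \<in> U"
  shows "pd i (pd j f) u = pd j (pd i f) u"
proof -
  have *: "pd k (pd l (\<lambda>w. b \<bullet> f w)) u = b \<bullet> pd k (pd l f) u" for k l b
  proof -
    have "pd k (pd l (\<lambda>w. b \<bullet> f w)) u = pd k (\<lambda>w. b \<bullet> pd l f w) u"
      by (rule pd_cong [OF U u], rule pd_bounded_linear [OF bounded_linear_inner_right])
         (rule smooth_on_imp_differentiable [OF f])
    also have "\<dots> = b \<bullet> pd k (pd l f) u"
      by (rule pd_bounded_linear [OF bounded_linear_inner_right])
         (rule smooth_on_imp_differentiable [OF smooth_on_pd [OF f] u])
    finally show ?thesis .
  qed
  \<comment> \<open>Pairing with the defect of symmetry itself reduces to real functions and yields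
    that its squared norm is 0.\<close>
  let ?b = "pd i (pd j f) u - pd j (pd i f) u"
  have "smooth_on U (\<lambda>w. ?b \<bullet> f w)"
    using smooth_on_bounded_linear [OF bounded_linear_inner_right f] .
  then have "pd i (pd j (\<lambda>w. ?b \<bullet> f w)) u = pd j (pd i (\<lambda>w. ?b \<bullet> f w)) u"
    by (intro pd_commute_real [OF U u] smooth_on_imp_differentiable [OF _ u]
        smooth_on_imp_differentiable [where U = U] smooth_on_pd)
  then have "?b \<bullet> ?b = 0"
    unfolding * by (simp add: inner_diff_right)
  then show ?thesis
    by simp
qed

end


section \<open>The curvature of the unit sphere\<close>

lemma smooth_on_ident:
  assumes "open (U :: (real^'m) set)"
  shows "smooth_on U (\<lambda>w. w)"
proof -
  have "times_differentiable_on n U (\<lambda>w. w)" for n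
  proof (cases n)
    case (Suc k)
    have "pd i (\<lambda>w. w) = (\<lambda>w. axis i 1)" for i :: 'm
      by (simp add: pd_def fun_eq_iff)
    then show ?thesis
      by (simp add: Suc times_differentiable_on_const)
  qed simp
  then show ?thesis
    by (simp add: smooth_on_iff_times_differentiable)
qed

lemma sphere_proj_inner:
  assumes "norm p = 1"
  shows "sphere_proj p v \<bullet> p = 0"
  using assms by (simp add: sphere_proj_def inner_diff_left norm_eq_1)

lemma linear_sphere_proj: "linear (sphere_proj p)"
  by (rule linearI) (simp_all add: sphere_proj_def inner_add_left algebra_simps)

lemma sphere_proj_tangent: "v \<bullet> p = 0 \<Longrightarrow> sphere_proj p v = v"
  by (simp add: sphere_proj_def)

text \<open>The projection of a constant vector extends a given tangent vector. The existence of
  such fields makes the condition in \<open>sphere_curvature\<close> determine its value.\<close>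

lemma sphere_field_sphere_proj:
  fixes v :: "real^'n"
  shows "sphere_field (\<lambda>q. sphere_proj q v)"
proof -
  have U: "open (- {0 :: real^'n})"
    by (rule open_Compl [OF closed_singleton])
  have id: "smooth_on (- {0 :: real^'n}) (\<lambda>z. z)"
    by (rule smooth_on_ident [OF U])
  have "smooth_on (- {0}) (\<lambda>z. (v \<bullet> z) *\<^sub>R z)"
    by (rule smooth_on_bilinear [OF U bounded_bilinear_scaleR
          smooth_on_bounded_linear [OF U bounded_linear_inner_right id] id])
  moreover have "smooth_on (- {0}) (\<lambda>z::real^'n. inverse (z \<bullet> z))"
    by (rule smooth_on_inverse [OF U smooth_on_bilinear [OF U bounded_bilinear_inner id id]]) simp
  ultimately have "smooth_on (- {0}) (\<lambda>z. inverse (z \<bullet> z) *\<^sub>R ((v \<bullet> z) *\<^sub>R z))"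
    by (intro smooth_on_bilinear [OF U bounded_bilinear_scaleR, where g = "\<lambda>z. (v \<bullet> z) *\<^sub>R z"])
  then have "smooth_on (- {0}) (\<lambda>z. v - inverse (z \<bullet> z) *\<^sub>R ((v \<bullet> z) *\<^sub>R z))"
    by (rule smooth_on_diff [OF U smooth_on_const [OF U]])
  moreover have "radial_ext (\<lambda>q. sphere_proj q v) = (\<lambda>z. v - inverse (z \<bullet> z) *\<^sub>R ((v \<bullet> z) *\<^sub>R z))"
    by (rule ext) (simp add: radial_ext_def sphere_proj_def dot_square_norm power2_eq_square)
  ultimately show ?thesis
    unfolding sphere_field_def by (intro conjI ballI) (simp_all add: sphere_proj_inner)
qed

text \<open>The derivative is the projection onto the tangent space, hence the identity on tangent
  directions; this removes the retraction from second covariant derivatives.\<close>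

lemma has_derivative_sphere_retraction:
  fixes p :: "'a::real_inner"
  assumes "norm p = 1"
  shows "((\<lambda>z. z /\<^sub>R norm z) has_derivative (\<lambda>h. h - (p \<bullet> h) *\<^sub>R p)) (at p)"
proof -
  have "p \<noteq> 0"
    using assms by auto
  then show ?thesis
    using assms
    by (auto intro!: derivative_eq_intros has_derivative_norm simp: sgn_div_norm fun_eq_iff inner_commute)
qed

lemma sphere_field_differentiable:
  assumes "sphere_field Z" "p \<noteq> 0"
  shows "radial_ext Z differentiable at p" "pd a (radial_ext Z) differentiable at p"
  using assms smooth_on_imp_differentiable smooth_on_pd
  unfolding sphere_field_def by blast+

lemma radial_ext_unit: "norm p = 1 \<Longrightarrow> radial_ext Z p = Z p"
  by (simp add: radial_ext_def)

text \<open>Differentiate the tangency relation \<open>radial_ext Z z \<bullet> z = 0\<close>, which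
  holds off the origin.\<close>

lemma sphere_field_deriv_inner:
  assumes "sphere_field Z" "norm p = 1"
  shows "frechet_derivative (radial_ext Z) (at p) h \<bullet> p = - (Z p \<bullet> h)"
proof -
  let ?D = "frechet_derivative (radial_ext Z) (at p)"
  have p: "p \<noteq> 0"
    using assms by auto
  have D: "(radial_ext Z has_derivative ?D) (at p)"
    using sphere_field_differentiable(1) [OF assms(1) p] by (simp add: frechet_derivative_works)
  have zero: "radial_ext Z z \<bullet> z = 0" if "z \<in> - {0}" for z
  proof -
    have "Z (z /\<^sub>R norm z) \<bullet> (z /\<^sub>R norm z) = 0"
      using assms(1) that by (simp add: sphere_field_def del: inner_scaleR_right)
    then show ?thesis
      using that by (simp add: radial_ext_def)
  qed
  have "((\<lambda>z. radial_ext Z z \<bullet> z) has_derivative (\<lambda>h. radial_ext Z p \<bullet> h + ?D h \<bullet> p)) (at p)"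
    by (rule has_derivative_inner [OF D has_derivative_ident])
  then have "((\<lambda>z. 0) has_derivative (\<lambda>h. radial_ext Z p \<bullet> h + ?D h \<bullet> p)) (at p)"
    by (rule has_derivative_transform_within_open [where s = "- {0}"]) (use p zero in \<open>auto intro: open_Compl\<close>)
  then have "(\<lambda>h. radial_ext Z p \<bullet> h + ?D h \<bullet> p) = (\<lambda>h. 0)"
    using has_derivative_const has_derivative_unique by blast
  then show ?thesis
    using assms(2) by (simp add: fun_eq_iff radial_ext_unit add_eq_0_iff)
qed

lemma sphere_nabla_unit:
  assumes "sphere_field Z" "norm q = 1"
  shows "sphere_nabla Y Z q = frechet_derivative (radial_ext Z) (at q) (Y q) + (Z q \<bullet> Y q) *\<^sub>R q"
  by (simp add: sphere_nabla_def sphere_proj_def sphere_deriv_def sphere_field_deriv_inner [OF assms])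

text \<open>The three summands are arranged for the curvature: the first is symmetric in
  \<open>X\<close> and \<open>Y\<close>, the second antisymmetrizes to the bracket term, and only
  the third survives.\<close>

lemma sphere_nabla_sphere_nabla:
  fixes X Y Z :: "real^'n \<Rightarrow> real^'n"
  assumes X: "sphere_field X" and Y: "sphere_field Y" and Z: "sphere_field Z" and p: "norm p = 1"
  shows "sphere_nabla X (sphere_nabla Y Z) p =
    sphere_proj p (\<Sum>a\<in>UNIV. (Y p $ a) *\<^sub>R (\<Sum>b\<in>UNIV. (X p $ b) *\<^sub>R pd b (pd a (radial_ext Z)) p))
    + sphere_proj p (frechet_derivative (radial_ext Z) (at p) (sphere_deriv X Y p))
    + (Z p \<bullet> Y p) *\<^sub>R X p"
proof -
  define N where "N = (\<lambda>z::real^'n. z /\<^sub>R norm z)"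
  define D where "D F = frechet_derivative (radial_ext F) (at p)" for F :: "real^'n \<Rightarrow> real^'n"
  have p0: "p \<noteq> 0" and Np: "N p = p"
    using p by (auto simp: N_def)
  have tang: "X p \<bullet> p = 0"
    using X p by (simp add: sphere_field_def)
  have N: "(N has_derivative (\<lambda>h. h - (p \<bullet> h) *\<^sub>R p)) (at p)"
    unfolding N_def by (rule has_derivative_sphere_retraction [OF p])
  have D: "(radial_ext F has_derivative D F) (at p)" if "sphere_field F" for F
    using sphere_field_differentiable(1) [OF that p0] by (simp add: D_def frechet_derivative_works)
  let ?Z = "radial_ext Z" and ?Y = "radial_ext Y"
  \<comment> \<open>The derivative of a radial extension is not constant along rays, so extending
    the inner covariant derivative radially evaluates it at \<open>N z\<close>, not at
    \<open>z\<close>.\<close>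
  have eq: "radial_ext (sphere_nabla Y Z) z =
      (\<Sum>a\<in>UNIV. (?Y z $ a) *\<^sub>R pd a ?Z (N z)) + (?Z z \<bullet> ?Y z) *\<^sub>R N z" if "z \<in> - {0}" for z
  proof -
    have q: "norm (N z) = 1" "N z \<noteq> 0"
      using that by (auto simp: N_def)
    show ?thesis
      using sphere_nabla_unit [OF Z q(1), of Y]
        frechet_derivative_eq_sum_pd [OF sphere_field_differentiable(1) [OF Z q(2)], of "Y (N z)"]
      by (simp add: radial_ext_def N_def)
  qed
  have D2: "((\<lambda>z. pd a ?Z (N z)) has_derivative
      (\<lambda>h. \<Sum>b\<in>UNIV. (h - (p \<bullet> h) *\<^sub>R p) $ b *\<^sub>R pd b (pd a ?Z) p)) (at p)" for a
    using has_derivative_compose [OF N, unfolded Np, OF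
        has_derivative_pd [OF sphere_field_differentiable(2) [OF Z p0]]] .
  have "((\<lambda>z. (\<Sum>a\<in>UNIV. (?Y z $ a) *\<^sub>R pd a ?Z (N z)) + (?Z z \<bullet> ?Y z) *\<^sub>R N z) has_derivative
      (\<lambda>h. (\<Sum>a\<in>UNIV. (?Y p $ a) *\<^sub>R (\<Sum>b\<in>UNIV. (h - (p \<bullet> h) *\<^sub>R p) $ b *\<^sub>R pd b (pd a ?Z) p)
             + (D Y h $ a) *\<^sub>R pd a ?Z (N p)) +
         ((?Z p \<bullet> ?Y p) *\<^sub>R (h - (p \<bullet> h) *\<^sub>R p) + (?Z p \<bullet> D Y h + D Z h \<bullet> ?Y p) *\<^sub>R N p))) (at p)"
    by (intro has_derivative_add has_derivative_sum has_derivative_scaleR has_derivative_inner D2 N D Y Z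
        bounded_linear.has_derivative [OF bounded_linear_vec_nth])
  then have der: "(radial_ext (sphere_nabla Y Z) has_derivative
      (\<lambda>h. (\<Sum>a\<in>UNIV. (?Y p $ a) *\<^sub>R (\<Sum>b\<in>UNIV. (h - (p \<bullet> h) *\<^sub>R p) $ b *\<^sub>R pd b (pd a ?Z) p)
             + (D Y h $ a) *\<^sub>R pd a ?Z (N p)) +
         ((?Z p \<bullet> ?Y p) *\<^sub>R (h - (p \<bullet> h) *\<^sub>R p) + (?Z p \<bullet> D Y h + D Z h \<bullet> ?Y p) *\<^sub>R N p))) (at p)"
    by (rule has_derivative_transform_within_open [where s = "- {0}"]) (use p0 eq in \<open>auto intro: open_Compl\<close>)
  have "sphere_deriv X (sphere_nabla Y Z) p =
      (\<Sum>a\<in>UNIV. (Y p $ a) *\<^sub>R (\<Sum>b\<in>UNIV. X p $ b *\<^sub>R pd b (pd a ?Z) p) + (D Y (X p) $ a) *\<^sub>R pd a ?Z p) +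
         ((Z p \<bullet> Y p) *\<^sub>R X p + (Z p \<bullet> D Y (X p) + D Z (X p) \<bullet> Y p) *\<^sub>R p)"
    unfolding sphere_deriv_def frechet_derivative_at [OF der, symmetric]
    using tang by (simp add: Np radial_ext_unit [OF p] inner_commute)
  also have "\<dots> = (\<Sum>a\<in>UNIV. (Y p $ a) *\<^sub>R (\<Sum>b\<in>UNIV. X p $ b *\<^sub>R pd b (pd a ?Z) p)) + D Z (D Y (X p)) +
         ((Z p \<bullet> Y p) *\<^sub>R X p + (Z p \<bullet> D Y (X p) + D Z (X p) \<bullet> Y p) *\<^sub>R p)"
    by (simp add: sum.distrib D_def frechet_derivative_eq_sum_pd [OF sphere_field_differentiable(1) [OF Z p0]])
  finally have "sphere_nabla X (sphere_nabla Y Z) p = sphere_proj p \<dots>"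
    by (simp add: sphere_nabla_def)
  moreover have "sphere_proj p p = 0"
    using p by (simp add: sphere_proj_def norm_eq_1)
  ultimately show ?thesis
    using tang unfolding D_def sphere_deriv_def
    by (simp add: linear_add [OF linear_sphere_proj] linear_scale [OF linear_sphere_proj] sphere_proj_tangent)
qed

lemma sphere_curvature_fields:
  fixes X Y Z :: "real^'n \<Rightarrow> real^'n"
  assumes X: "sphere_field X" and Y: "sphere_field Y" and Z: "sphere_field Z" and p: "norm p = 1"
  shows "sphere_nabla X (sphere_nabla Y Z) p - sphere_nabla Y (sphere_nabla X Z) p
      - sphere_nabla (sphere_bracket X Y) Z p = (Z p \<bullet> Y p) *\<^sub>R X p - (Z p \<bullet> X p) *\<^sub>R Y p"
proof -
  let ?Z = "radial_ext Z"
  have p0: "p \<noteq> 0"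
    using p by auto
  have "pd b (pd a ?Z) p = pd a (pd b ?Z) p" for a b
    by (rule pd_commute [where U = "- {0}"]) (use Z p0 in \<open>auto simp: sphere_field_def intro: open_Compl\<close>)
  then have "(\<Sum>a\<in>UNIV. (Y p $ a) *\<^sub>R (\<Sum>b\<in>UNIV. (X p $ b) *\<^sub>R pd b (pd a ?Z) p)) =
      (\<Sum>a\<in>UNIV. (X p $ a) *\<^sub>R (\<Sum>b\<in>UNIV. (Y p $ b) *\<^sub>R pd b (pd a ?Z) p))"
    unfolding scaleR_sum_right by (subst sum.swap) (simp add: mult.commute)
  moreover have "linear (frechet_derivative ?Z (at p))"
    by (rule linear_frechet_derivative [OF sphere_field_differentiable(1) [OF Z p0]])
  ultimately show ?thesis
    unfolding sphere_nabla_sphere_nabla [OF X Y Z p] sphere_nabla_sphere_nabla [OF Y X Z p]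
    by (simp add: sphere_nabla_def [of "sphere_bracket X Y"] sphere_bracket_def
        sphere_deriv_def [of "sphere_bracket X Y"] linear_diff linear_diff [OF linear_sphere_proj])
qed

text \<open>Constant curvature 1. Any candidate value is tested on the projections of constant
  vectors; that the formula is a value at all is \<open>sphere_curvature_fields\<close>.\<close>

lemma sphere_curvature_eq:
  fixes v w z :: "real^'n"
  assumes p: "norm p = 1" and "v \<bullet> p = 0" "w \<bullet> p = 0" "z \<bullet> p = 0"
  shows "sphere_curvature p v w z = (z \<bullet> w) *\<^sub>R v - (z \<bullet> v) *\<^sub>R w"
  unfolding sphere_curvature_def
proof (rule the_equality)
  fix r
  assume r: "\<forall>X Y Z. sphere_field X \<and> sphere_field Y \<and> sphere_field Z \<and> X p = v \<and> Y p = w \<and> Z p = z \<longrightarrow>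
    r = sphere_nabla X (sphere_nabla Y Z) p - sphere_nabla Y (sphere_nabla X Z) p
            - sphere_nabla (sphere_bracket X Y) Z p"
  let ?F = "\<lambda>v q. sphere_proj q v"
  have "?F v p = v" "?F w p = w" "?F z p = z"
    using assms by (simp_all add: sphere_proj_tangent)
  then show "r = (z \<bullet> w) *\<^sub>R v - (z \<bullet> v) *\<^sub>R w"
    using r [rule_format, of "?F v" "?F w" "?F z"]
      sphere_curvature_fields [of "?F v" "?F w" "?F z" p] p
    by (simp add: sphere_field_sphere_proj)
qed (use sphere_curvature_fields [OF _ _ _ p] in auto)


section \<open>Matrix inverses\<close>

lemma matrix_inv_works:
  fixes A :: "real^'m^'m"
  assumes "invertible A"
  shows "A ** matrix_inv A = mat 1" "matrix_inv A ** A = mat 1"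
proof -
  have "A ** matrix_inv A = mat 1 \<and> matrix_inv A ** A = mat 1"
    unfolding matrix_inv_def using assms unfolding invertible_def by (rule someI_ex)
  then show "A ** matrix_inv A = mat 1" "matrix_inv A ** A = mat 1"
    by auto
qed

text \<open>Cramer's rule makes the entries of the inverse rational in those of the matrix, which is
  how smoothness passes from the metric to the cometric.\<close>

lemma matrix_inv_nth_eq_det:
  fixes A :: "real^'m^'m"
  assumes "invertible A"
  shows "matrix_inv A $ i $ j = det (\<chi> a b. if b = i then axis j 1 $ a else A $ a $ b) * inverse (det A)"
proof -
  have det: "det A \<noteq> 0"
    using assms by (simp add: invertible_det_nz)
  have "A *v (matrix_inv A *v axis j 1) = axis j 1"
    by (simp add: matrix_vector_mul_assoc matrix_inv_works [OF assms])
  then have "(matrix_inv A *v axis j 1) $ i = det (\<chi> a b. if b = i then axis j 1 $ a else A $ a $ b) / det A"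
    unfolding cramer [OF det] by simp
  moreover have "(matrix_inv A *v axis j 1) $ i = matrix_inv A $ i $ j"
    by (simp add: matrix_vector_mult_basis column_def)
  ultimately show ?thesis
    by (simp add: divide_inverse)
qed

lemma smooth_on_det:
  fixes A :: "real^'m \<Rightarrow> real^'k^'k"
  assumes "open U" "\<And>i j. smooth_on U (\<lambda>u. A u $ i $ j)"
  shows "smooth_on U (\<lambda>u. det (A u))"
  unfolding det_def
  by (intro smooth_on_sum smooth_on_bounded_linear [OF _ bounded_linear_mult_right] smooth_on_prod assms)


section \<open>The Laplacian and the mean curvature vector in a chart\<close>

text \<open>The plain trace of the Hessian, of opposite sign to \<open>laplacian\<close>, and for
  vector-valued maps, so that no components are needed.\<close>

definition chart_laplacian ::
    "(real^'m \<Rightarrow> real^'n) \<Rightarrow> (real^'m \<Rightarrow> 'b::real_normed_vector) \<Rightarrow> real^'m \<Rightarrow> 'b" where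
  "chart_laplacian x F u = metric_trace x u
     (\<lambda>i j. pd i (pd j F) u - (\<Sum>k\<in>UNIV. christoffel x u k i j *\<^sub>R pd k F u))"

text \<open>One fixed chart serves all \<open>u\<close>, so this can be differentiated;
  \<open>mean_curvature_vector\<close> picks a chart at each point.\<close>

definition chart_mean_curvature :: "(real^'m \<Rightarrow> real^'n) \<Rightarrow> real^'m \<Rightarrow> real^'n" where
  "chart_mean_curvature x u =
     (1 / real CARD('m)) *\<^sub>R metric_trace x u (second_fundamental_form x u)"

lemma metric_trace_add:
  "metric_trace x u (\<lambda>i j. S i j + T i j) = metric_trace x u S + metric_trace x u T"
  by (simp add: metric_trace_def algebra_simps sum.distrib)

lemma metric_trace_diff:
  "metric_trace x u (\<lambda>i j. S i j - T i j) = metric_trace x u S - metric_trace x u T"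
  by (simp add: metric_trace_def algebra_simps sum_subtractf)

lemma metric_trace_linear:
  assumes "linear L"
  shows "metric_trace x u (\<lambda>i j. L (T i j)) = L (metric_trace x u T)"
  by (simp add: metric_trace_def linear_sum [OF assms] linear_scale [OF assms])

lemma inner_metric_trace:
  fixes T :: "'m::finite \<Rightarrow> 'm \<Rightarrow> 'b::real_inner"
  shows "v \<bullet> metric_trace x u T = metric_trace x u (\<lambda>i j. v \<bullet> T i j)"
  by (simp add: metric_trace_def inner_sum_right)

lemma metric_trace_scaleR_left:
  "metric_trace x u (\<lambda>i j. T i j *\<^sub>R v) = metric_trace x u T *\<^sub>R v"
  by (simp add: metric_trace_def scaleR_sum_left)

lemma metric_sym: "metric x u $ i $ j = metric x u $ j $ i"
  by (simp add: metric_def inner_commute)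

locale sphere_chart =
  fixes U :: "(real^'m) set" and x :: "real^'m \<Rightarrow> real^'n"
  assumes open_U: "open U"
    and smooth_x: "smooth_on U x"
    and immersion: "u \<in> U \<Longrightarrow> inj (frechet_derivative x (at u))"
    and norm_x: "u \<in> U \<Longrightarrow> norm (x u) = 1"
begin

lemma smooth_differentiable:
  assumes "smooth_on U F" "u \<in> U"
  shows "F differentiable at u" "pd i F differentiable at u"
  using assms smooth_on_imp_differentiable smooth_on_pd by blast+

section \<open>Linear algebra of the induced metric\<close>

lemma frame_independent:
  assumes "u \<in> U" "(\<Sum>i\<in>UNIV. b i *\<^sub>R pd i x u) = 0"
  shows "b i = 0"
proof -
  let ?D = "frechet_derivative x (at u)"
  have dx: "x differentiable at u"
    using smooth_x assms(1) smooth_on_imp_differentiable by blast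
  have "?D (\<chi> i. b i) = ?D 0"
    using assms(2) by (simp add: frechet_derivative_eq_sum_pd [OF dx])
  then have "(\<chi> i. b i) = 0"
    using immersion [OF assms(1)] by (rule injD [rotated])
  then show ?thesis
    by (simp add: vec_eq_iff)
qed

lemma metric_form: "w \<bullet> (metric x u *v w) = (norm (\<Sum>i\<in>UNIV. w $ i *\<^sub>R pd i x u))\<^sup>2"
proof -
  have "metric x u $ i $ j = pd j x u \<bullet> pd i x u" for i j
    by (simp add: metric_def inner_commute)
  then have "w \<bullet> (metric x u *v w) = (\<Sum>i\<in>UNIV. \<Sum>j\<in>UNIV. w $ i * (w $ j * (pd j x u \<bullet> pd i x u)))"
    by (simp add: inner_vec_def [of w] matrix_vector_mult_def sum_distrib_left mult_ac)
  then show ?thesis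
    by (simp add: power2_norm_eq_inner inner_sum_left inner_sum_right sum_distrib_left)
qed

lemma invertible_metric:
  assumes "u \<in> U"
  shows "invertible (metric x u)"
proof -
  have "w = 0" if "metric x u *v w = 0" for w
  proof -
    have "(\<Sum>i\<in>UNIV. w $ i *\<^sub>R pd i x u) = 0"
      using metric_form [of w u] that by simp
    then have "w $ i = 0" for i
      using frame_independent [OF assms, of "\<lambda>i. w $ i"] by blast
    then show ?thesis
      by (simp add: vec_eq_iff)
  qed
  then show ?thesis
    by (simp add: invertible_left_inverse matrix_left_invertible_ker)
qed

lemma cometric_metric:
  assumes "u \<in> U"
  shows "metric x u ** cometric x u = mat 1" "cometric x u ** metric x u = mat 1"
  unfolding cometric_def using matrix_inv_works [OF invertible_metric [OF assms]] by auto

lemma cometric_sym: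
  assumes "u \<in> U"
  shows "cometric x u $ i $ j = cometric x u $ j $ i"
proof -
  let ?g = "metric x u" and ?c = "cometric x u"
  have g: "transpose ?g = ?g"
    by (simp add: transpose_def vec_eq_iff metric_sym)
  have "transpose ?c ** ?g = transpose (?g ** ?c)"
    by (simp add: matrix_transpose_mul g)
  then have tc: "transpose ?c ** ?g = mat 1"
    by (simp only: cometric_metric [OF assms] transpose_mat)
  have "transpose ?c = transpose ?c ** ?g ** ?c"
    by (simp add: matrix_mul_assoc [symmetric] cometric_metric [OF assms])
  also have "\<dots> = ?c"
    by (simp only: tc matrix_mul_lid)
  finally have "transpose ?c $ j $ i = ?c $ j $ i"
    by (rule arg_cong)
  then show ?thesis
    by (simp add: transpose_def)
qed

lemma sum_cometric_metric:
  assumes "u \<in> U"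
  shows "(\<Sum>k\<in>UNIV. cometric x u $ i $ k * metric x u $ k $ j) = (if i = j then 1 else 0)"
  using cometric_metric(2) [OF assms] by (simp add: matrix_matrix_mult_def mat_def vec_eq_iff)

lemma metric_trace_metric:
  assumes "u \<in> U"
  shows "metric_trace x u (\<lambda>i j. metric x u $ i $ j) = real CARD('m)"
proof -
  have "metric_trace x u (\<lambda>i j. metric x u $ i $ j)
      = (\<Sum>i\<in>UNIV. \<Sum>j\<in>UNIV. cometric x u $ i $ j * metric x u $ j $ i)"
    by (simp add: metric_trace_def metric_sym)
  then show ?thesis
    by (simp add: sum_cometric_metric [OF assms])
qed

text \<open>Raise the index: with \<open>b = cometric x u *v a\<close> both sides equal
  \<open>b \<bullet> a\<close>. This gives positivity of the trace without orthonormal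
  frames.\<close>

lemma metric_trace_square:
  fixes a :: "real^'m"
  assumes "u \<in> U"
  shows "metric_trace x u (\<lambda>i j. a $ i * a $ j) =
    (norm (\<Sum>i\<in>UNIV. (cometric x u *v a) $ i *\<^sub>R pd i x u))\<^sup>2"
proof -
  have "metric x u *v (cometric x u *v a) = a"
    by (simp add: matrix_vector_mul_assoc cometric_metric [OF assms])
  then have "(norm (\<Sum>i\<in>UNIV. (cometric x u *v a) $ i *\<^sub>R pd i x u))\<^sup>2 = (cometric x u *v a) \<bullet> a"
    using metric_form [of "cometric x u *v a" u] by simp
  also have "\<dots> = metric_trace x u (\<lambda>i j. a $ i * a $ j)"
    by (simp add: metric_trace_def inner_vec_def matrix_vector_mult_def sum_distrib_left sum_distrib_right mult_ac)
  finally show ?thesis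
    by simp
qed

lemma metric_trace_inner:
  fixes a :: "'m \<Rightarrow> real^'k"
  assumes "u \<in> U"
  shows "metric_trace x u (\<lambda>i j. a i \<bullet> a j) =
    (\<Sum>k\<in>UNIV. metric_trace x u (\<lambda>i j. (\<chi> i. a i $ k) $ i * (\<chi> i. a i $ k) $ j))"
  unfolding metric_trace_def inner_vec_def real_scaleR_def sum_distrib_left
  by (subst sum.swap, rule sum.cong [OF refl], subst sum.swap) simp

lemma metric_trace_inner_nonneg:
  fixes a :: "'m \<Rightarrow> real^'k"
  assumes "u \<in> U"
  shows "metric_trace x u (\<lambda>i j. a i \<bullet> a j) \<ge> 0"
  unfolding metric_trace_inner [OF assms] metric_trace_square [OF assms] by (simp add: sum_nonneg)

lemma metric_trace_inner_eq_0:
  fixes a :: "'m \<Rightarrow> real^'k"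
  assumes u: "u \<in> U" and "metric_trace x u (\<lambda>i j. a i \<bullet> a j) = 0"
  shows "a i = 0"
proof -
  have "a i $ k = 0" for k
  proof -
    let ?a = "\<chi> i. a i $ k"
    have "(\<Sum>k\<in>UNIV. (norm (\<Sum>i\<in>UNIV. (cometric x u *v (\<chi> i. a i $ k)) $ i *\<^sub>R pd i x u))\<^sup>2) = 0"
      using assms(2) unfolding metric_trace_inner [OF u] metric_trace_square [OF u] .
    then have "(\<Sum>i\<in>UNIV. (cometric x u *v ?a) $ i *\<^sub>R pd i x u) = 0"
      by (subst (asm) sum_nonneg_eq_0_iff) auto
    then have "(cometric x u *v ?a) $ i = 0" for i
      by (rule frame_independent [OF u])
    then have "cometric x u *v ?a = 0"
      by (simp add: vec_eq_iff)
    then have "(metric x u ** cometric x u) *v ?a = 0"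
      by (simp add: matrix_vector_mul_assoc [symmetric])
    then show ?thesis
      by (simp add: cometric_metric [OF u] vec_eq_iff)
  qed
  then show ?thesis
    by (simp add: vec_eq_iff)
qed

section \<open>Gauss formula and normality of the mean curvature vector\<close>

lemma pd_metric:
  assumes "u \<in> U"
  shows "pd k (\<lambda>w. metric x w $ i $ j) u = pd k (pd i x) u \<bullet> pd j x u + pd i x u \<bullet> pd k (pd j x) u"
  unfolding metric_def
  using pd_inner [OF smooth_differentiable(2) [OF smooth_x assms] smooth_differentiable(2) [OF smooth_x assms]]
  by simp

text \<open>Expand the three derivatives of the metric by the product rule: since mixed derivatives
  commute, four of the six terms cancel and the other two coincide.\<close>

lemma sum_christoffel_metric:
  assumes "u \<in> U"
  shows "(\<Sum>k\<in>UNIV. christoffel x u k i j * (pd k x u \<bullet> pd l x u)) = pd i (pd j x) u \<bullet> pd l x u"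
proof -
  define E where "E l = pd i (\<lambda>w. metric x w $ j $ l) u + pd j (\<lambda>w. metric x w $ i $ l) u
        - pd l (\<lambda>w. metric x w $ i $ j) u" for l
  have com: "pd a (pd b x) u = pd b (pd a x) u" for a b
    by (rule pd_commute [OF open_U smooth_x assms])
  have E: "E l = 2 * (pd i (pd j x) u \<bullet> pd l x u)"
    unfolding E_def pd_metric [OF assms] by (simp add: com [of l] com [of j i] inner_commute)
  have "(\<Sum>k\<in>UNIV. christoffel x u k i j * metric x u $ k $ l) =
      (1 / 2) * (\<Sum>k\<in>UNIV. \<Sum>n\<in>UNIV. E n * (cometric x u $ n $ k * metric x u $ k $ l))"
    unfolding christoffel_def E_def [symmetric] sum_distrib_left sum_distrib_right
    by (intro sum.cong refl) (simp add: cometric_sym [OF assms])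
  also have "\<dots> = (1 / 2) * (\<Sum>n\<in>UNIV. E n * (\<Sum>k\<in>UNIV. cometric x u $ n $ k * metric x u $ k $ l))"
    unfolding sum_distrib_left by (subst sum.swap) simp
  also have "\<dots> = (1 / 2) * E l"
    by (simp add: sum_cometric_metric [OF assms] if_distrib sum.If_cases cong: if_cong)
  finally show ?thesis
    by (simp add: E metric_def)
qed

text \<open>Gauss formula: the Christoffel terms are exactly the tangential part of the second
  derivatives.\<close>

lemma hessian_orthogonal:
  assumes "u \<in> U"
  shows "(pd i (pd j x) u - (\<Sum>k\<in>UNIV. christoffel x u k i j *\<^sub>R pd k x u)) \<bullet> pd l x u = 0"
  using sum_christoffel_metric [OF assms, of i j l] by (simp add: inner_diff_left inner_sum_left)

lemma pd_inner_const:
  assumes "u \<in> U" and "smooth_on U V" "smooth_on U W" and "\<And>w. w \<in> U \<Longrightarrow> V w \<bullet> W w = c"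
  shows "pd i V u \<bullet> W u + V u \<bullet> pd i W u = 0"
proof -
  have "pd i (\<lambda>w. V w \<bullet> W w) u = pd i (\<lambda>w. c) u"
    by (rule pd_cong [OF open_U assms(1)]) (rule assms(4))
  then show ?thesis
    by (simp add: pd_inner [OF smooth_differentiable(1) [OF assms(2,1)] smooth_differentiable(1) [OF assms(3,1)]])
qed

lemma x_inner_x: "u \<in> U \<Longrightarrow> x u \<bullet> x u = 1"
  using norm_x by (simp add: norm_eq_1)

lemma x_inner_pd:
  assumes "u \<in> U"
  shows "x u \<bullet> pd i x u = 0"
  using pd_inner_const [OF assms smooth_x smooth_x x_inner_x, of i] by (simp add: inner_commute)

lemma x_inner_pd_pd:
  assumes "u \<in> U"
  shows "x u \<bullet> pd i (pd j x) u = - metric x u $ i $ j"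
  using pd_inner_const [OF assms smooth_x smooth_on_pd [OF smooth_x] x_inner_pd, of i j]
  by (simp add: metric_def)

text \<open>By \<open>x_inner_pd_pd\<close> the radial part of \<open>pd i (pd j x)\<close> is
  \<open>- metric x u $ i $ j\<close> times \<open>x u\<close>; projecting to the sphere removes
  it.\<close>

lemma second_fundamental_form_eq:
  assumes "u \<in> U"
  shows "second_fundamental_form x u i j =
    pd i (pd j x) u - (\<Sum>k\<in>UNIV. christoffel x u k i j *\<^sub>R pd k x u) + metric x u $ i $ j *\<^sub>R x u"
  using x_inner_pd_pd [OF assms, of i j]
  by (simp add: second_fundamental_form_def pullback_nabla_def sphere_proj_def inner_commute)

lemma chart_laplacian_x:
  assumes "u \<in> U"
  shows "chart_laplacian x x u = real CARD('m) *\<^sub>R (chart_mean_curvature x u - x u)"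
proof -
  have "metric_trace x u (second_fundamental_form x u) = chart_laplacian x x u + real CARD('m) *\<^sub>R x u"
    by (simp add: second_fundamental_form_eq [OF assms, abs_def] metric_trace_add metric_trace_scaleR_left
        metric_trace_metric [OF assms] chart_laplacian_def)
  then show ?thesis
    by (simp add: chart_mean_curvature_def algebra_simps)
qed

lemma mean_curvature_normal:
  assumes "u \<in> U"
  shows "pd l x u \<bullet> chart_mean_curvature x u = 0" "x u \<bullet> chart_mean_curvature x u = 0"
proof -
  have "pd l x u \<bullet> second_fundamental_form x u i j = 0" for i j
    using hessian_orthogonal [OF assms, of i j l] x_inner_pd [OF assms, of l]
    by (simp add: second_fundamental_form_eq [OF assms] inner_add_right inner_commute)
  moreover have "x u \<bullet> second_fundamental_form x u i j = 0" for i j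
    using x_inner_pd_pd [OF assms, of i j] x_inner_pd [OF assms] x_inner_x [OF assms]
    by (simp add: second_fundamental_form_eq [OF assms] inner_add_right inner_diff_right inner_sum_right)
  ultimately show "pd l x u \<bullet> chart_mean_curvature x u = 0" "x u \<bullet> chart_mean_curvature x u = 0"
    by (simp_all add: chart_mean_curvature_def inner_metric_trace) (simp_all add: metric_trace_def)
qed

section \<open>Smoothness of the metric quantities and of the mean curvature vector\<close>

lemma smooth_on_metric: "smooth_on U (\<lambda>u. metric x u $ i $ j)"
  by (simp add: metric_def)
     (intro smooth_on_bilinear [OF open_U bounded_bilinear_inner] smooth_on_pd smooth_x)

lemma smooth_on_cometric: "smooth_on U (\<lambda>u. cometric x u $ i $ j)"
proof -
  have minor: "smooth_on U (\<lambda>u. det (\<chi> a b. if b = i then axis j 1 $ a else metric x u $ a $ b))"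
  proof (rule smooth_on_det [OF open_U])
    fix a b
    show "smooth_on U (\<lambda>u. (\<chi> a b. if b = i then axis j 1 $ a else metric x u $ a $ b) $ a $ b)"
      by (cases "b = i") (simp_all add: smooth_on_const [OF open_U] smooth_on_metric)
  qed
  have "smooth_on U (\<lambda>u. inverse (det (metric x u)))"
    by (rule smooth_on_inverse [OF open_U smooth_on_det [OF open_U smooth_on_metric]])
       (use invertible_metric invertible_det_nz in blast)
  then have "smooth_on U (\<lambda>u. det (\<chi> a b. if b = i then axis j 1 $ a else metric x u $ a $ b)
      * inverse (det (metric x u)))"
    by (rule smooth_on_bilinear [OF open_U bounded_bilinear_mult minor])
  then show ?thesis
    using smooth_on_cong [OF open_U matrix_inv_nth_eq_det [OF invertible_metric]]
    by (simp add: cometric_def)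
qed

lemma smooth_on_christoffel: "smooth_on U (\<lambda>u. christoffel x u k i j)"
  unfolding christoffel_def
  by (intro smooth_on_bounded_linear [OF open_U bounded_linear_mult_right] smooth_on_sum [OF open_U]
      smooth_on_bilinear [OF open_U bounded_bilinear_mult] smooth_on_cometric
      smooth_on_diff [OF open_U] smooth_on_add [OF open_U] smooth_on_pd smooth_on_metric)

lemma smooth_on_chart_mean_curvature: "smooth_on U (chart_mean_curvature x)"
proof -
  \<comment> \<open>This is \<open>chart_laplacian_x\<close> solved for the mean curvature
    vector.\<close>
  have "smooth_on U (\<lambda>u. x u + (1 / real CARD('m)) *\<^sub>R chart_laplacian x x u)"
    unfolding chart_laplacian_def metric_trace_def
    by (intro smooth_on_add [OF open_U] smooth_x smooth_on_bounded_linear [OF open_U bounded_linear_scaleR_right]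
        smooth_on_sum [OF open_U] smooth_on_bilinear [OF open_U bounded_bilinear_scaleR] smooth_on_cometric
        smooth_on_diff [OF open_U] smooth_on_pd smooth_on_christoffel)
  then show ?thesis
    using smooth_on_cong [OF open_U, of "chart_mean_curvature x"
        "\<lambda>u. x u + (1 / real CARD('m)) *\<^sub>R chart_laplacian x x u"]
    by (simp add: chart_laplacian_x)
qed

text \<open>On a normal section the connection of the sphere differs from the flat one only in the second
  derivative, and there only by a multiple of the position vector.\<close>

lemma metric_trace_pullback_nabla2:
  assumes u: "u \<in> U" and V: "smooth_on U V"
    and normal: "\<And>w. w \<in> U \<Longrightarrow> x w \<bullet> V w = 0" "\<And>w l. w \<in> U \<Longrightarrow> pd l x w \<bullet> V w = 0"
  shows "metric_trace x u (pullback_nabla2 x V u) =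
    chart_laplacian x V u - (real CARD('m) * (V u \<bullet> chart_mean_curvature x u)) *\<^sub>R x u"
proof -
  have V_x: "pd j V w \<bullet> x w = 0" if "w \<in> U" for j w
    using pd_inner_const [OF that V smooth_x, where c = 0 and i = j] normal that by (simp add: inner_commute)
  have nabla: "pullback_nabla x j V w = pd j V w" if "w \<in> U" for j w
    using V_x [OF that] by (simp add: pullback_nabla_def sphere_proj_def)
  \<comment> \<open>Differentiating \<open>V \<bullet> x = 0\<close> twice and
    \<open>V \<bullet> pd i x = 0\<close> once moves both derivatives from \<open>V\<close> to
    \<open>x\<close>, where the trace is known.\<close>
  have "pd i (pd j V) u \<bullet> x u = V u \<bullet> pd i (pd j x) u" for i j
  proof -
    have "pd i (pd j V) u \<bullet> x u = - (pd j V u \<bullet> pd i x u)"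
      using pd_inner_const [OF u smooth_on_pd [OF V] smooth_x V_x, of i j] by simp
    moreover have "pd j V u \<bullet> pd i x u + V u \<bullet> pd j (pd i x) u = 0"
      by (rule pd_inner_const [OF u V smooth_on_pd [OF smooth_x]]) (use normal in \<open>simp add: inner_commute\<close>)
    ultimately show ?thesis
      using pd_commute [OF open_U smooth_x u, of i j] by simp
  qed
  then have "pullback_nabla x i (pullback_nabla x j V) u = pd i (pd j V) u - (V u \<bullet> pd i (pd j x) u) *\<^sub>R x u" for i j
    unfolding pullback_nabla_def [of x i] sphere_proj_def
    by (simp add: pd_cong [OF open_U u nabla])
  then have "pullback_nabla2 x V u i j = pd i (pd j V) u - (\<Sum>k\<in>UNIV. christoffel x u k i j *\<^sub>R pd k V u)
      - (V u \<bullet> pd i (pd j x) u) *\<^sub>R x u" for i j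
    by (simp add: pullback_nabla2_def nabla [OF u])
  then have "metric_trace x u (pullback_nabla2 x V u) =
      chart_laplacian x V u - metric_trace x u (\<lambda>i j. V u \<bullet> pd i (pd j x) u) *\<^sub>R x u"
    unfolding chart_laplacian_def metric_trace_scaleR_left [symmetric] metric_trace_diff [symmetric]
    by (simp add: metric_trace_def)
  \<comment> \<open>The Christoffel terms can be inserted for free because \<open>V\<close> is
    orthogonal to the \<open>pd k x\<close>.\<close>
  moreover have "metric_trace x u (\<lambda>i j. V u \<bullet> pd i (pd j x) u) = V u \<bullet> chart_laplacian x x u"
    unfolding chart_laplacian_def inner_metric_trace using normal(2) [OF u]
    by (simp add: inner_diff_right inner_sum_right inner_commute)
  ultimately show ?thesis
    using normal(1) [OF u] by (simp add: chart_laplacian_x [OF u] inner_diff_right inner_commute)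
qed

text \<open>As \<open>V\<close> is normal, constant curvature 1 leaves only
  \<open>- metric x u $ i $ j\<close> times \<open>V\<close>, and the trace of the metric is the
  dimension.\<close>

lemma metric_trace_sphere_curvature:
  assumes u: "u \<in> U" and V: "x u \<bullet> V = 0" "\<And>l. pd l x u \<bullet> V = 0"
  shows "metric_trace x u (\<lambda>i j. sphere_curvature (x u) (pd i x u) V (pd j x u)) = - real CARD('m) *\<^sub>R V"
proof -
  have "sphere_curvature (x u) (pd i x u) V (pd j x u) = - metric x u $ i $ j *\<^sub>R V" for i j
    using sphere_curvature_eq [OF norm_x [OF u], of "pd i x u" V "pd j x u"] V x_inner_pd [OF u]
    by (simp add: inner_commute metric_def)
  then show ?thesis
    by (simp add: metric_trace_scaleR_left metric_trace_linear [OF linear_uminus]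
        metric_trace_metric [OF u] del: scaleR_minus_left)
qed

text \<open>Differentiate \<open>F \<bullet> F = c\<close> twice; the first derivative,
  \<open>F \<bullet> pd k F = 0\<close>, also removes the Christoffel terms.\<close>

lemma inner_chart_laplacian_of_norm_const:
  fixes F :: "real^'m \<Rightarrow> real^'k"
  assumes u: "u \<in> U" and F: "smooth_on U F" and const: "\<And>w. w \<in> U \<Longrightarrow> F w \<bullet> F w = c"
  shows "F u \<bullet> chart_laplacian x F u = - metric_trace x u (\<lambda>i j. pd i F u \<bullet> pd j F u)"
proof -
  have F1: "F w \<bullet> pd j F w = 0" if "w \<in> U" for w j
    using pd_inner_const [OF that F F const, of j] by (simp add: inner_commute)
  have "F u \<bullet> pd i (pd j F) u = - (pd i F u \<bullet> pd j F u)" for i j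
    using pd_inner_const [OF u F smooth_on_pd [OF F] F1, of i j] by simp
  then show ?thesis
    unfolding chart_laplacian_def inner_metric_trace
    by (simp add: inner_diff_right inner_sum_right F1 [OF u] metric_trace_linear [OF linear_uminus])
qed

section \<open>Locality and linearity of the Laplacian in a chart\<close>

lemma chart_laplacian_cong:
  assumes "u \<in> U" "\<And>w. w \<in> U \<Longrightarrow> F w = G w"
  shows "chart_laplacian x F u = chart_laplacian x G u"
proof -
  have "pd k F w = pd k G w" if "w \<in> U" for k w
    by (rule pd_cong [OF open_U that assms(2)])
  then show ?thesis
    unfolding chart_laplacian_def using pd_cong [OF open_U assms(1), of "pd _ F" "pd _ G"] assms(1) by simp
qed

lemma chart_laplacian_add:
  assumes "u \<in> U" "smooth_on U F" "smooth_on U G"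
  shows "chart_laplacian x (\<lambda>w. F w + G w) u = chart_laplacian x F u + chart_laplacian x G u"
proof -
  have 1: "pd k (\<lambda>w. F w + G w) w = pd k F w + pd k G w" if "w \<in> U" for k w
    by (rule pd_add) (use assms that smooth_differentiable in blast)+
  have "pd i (pd k (\<lambda>w. F w + G w)) u = pd i (pd k F) u + pd i (pd k G) u" for i k
    by (simp add: pd_cong [OF open_U assms(1) 1] pd_add
        smooth_differentiable(2) [OF assms(2,1)] smooth_differentiable(2) [OF assms(3,1)])
  then show ?thesis
    unfolding chart_laplacian_def
    by (simp add: 1 assms(1) metric_trace_add [symmetric] sum.distrib algebra_simps)
qed

lemma chart_laplacian_bounded_linear:
  assumes "u \<in> U" "smooth_on U F" "bounded_linear L"
  shows "chart_laplacian x (\<lambda>w. L (F w)) u = L (chart_laplacian x F u)"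
proof -
  interpret L: bounded_linear L
    by fact
  have 1: "pd k (\<lambda>w. L (F w)) w = L (pd k F w)" if "w \<in> U" for k w
    by (rule pd_bounded_linear) (use assms that smooth_differentiable in blast)+
  have "pd i (pd k (\<lambda>w. L (F w))) u = L (pd i (pd k F) u)" for i k
    by (simp add: pd_cong [OF open_U assms(1) 1]
        pd_bounded_linear [OF assms(3) smooth_differentiable(2) [OF assms(2,1)]])
  then show ?thesis
    unfolding chart_laplacian_def
    by (simp add: 1 assms(1) L.diff L.sum L.scaleR metric_trace_linear [OF L.linear, symmetric])
qed

lemma chart_laplacian_const: "chart_laplacian x (\<lambda>w. c) u = 0"
  by (simp add: chart_laplacian_def metric_trace_def pd_const [THEN ext])

end


section \<open>Change of charts\<close>

lemma metric_trace_in_span: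
  "(\<And>i j. T i j \<in> span S) \<Longrightarrow> metric_trace x u T \<in> span S"
  unfolding metric_trace_def by (intro span_sum span_scale)

lemma sum_rotate:
  "(\<Sum>i\<in>A. \<Sum>a\<in>B. \<Sum>b\<in>C. g i a b) = (\<Sum>a\<in>B. \<Sum>b\<in>C. \<Sum>i\<in>A. g i a b)"
  by (subst sum.swap, rule sum.cong [OF refl], rule sum.swap)

text \<open>Pulling a bilinear form back by \<open>J\<close> and contracting with \<open>C\<close>
  is contracting the form with \<open>J C J^T\<close>. It is applied to a Jacobian \<open>J\<close>
  and the cometric \<open>C\<close>.\<close>

lemma sum_matrix_transform:
  fixes C :: "real^'m^'m" and J :: "real^'m^'k" and T :: "'k \<Rightarrow> 'k \<Rightarrow> 'b::real_vector"
  shows "(\<Sum>i\<in>UNIV. \<Sum>j\<in>UNIV. C $ i $ j *\<^sub>R (\<Sum>a\<in>UNIV. \<Sum>b\<in>UNIV. (J $ a $ i * J $ b $ j) *\<^sub>R T a b)) =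
    (\<Sum>a\<in>UNIV. \<Sum>b\<in>UNIV. (J ** C ** transpose J) $ a $ b *\<^sub>R T a b)"
proof -
  have "(\<Sum>i\<in>UNIV. \<Sum>j\<in>UNIV. C $ i $ j *\<^sub>R (\<Sum>a\<in>UNIV. \<Sum>b\<in>UNIV. (J $ a $ i * J $ b $ j) *\<^sub>R T a b)) =
      (\<Sum>i\<in>UNIV. \<Sum>j\<in>UNIV. \<Sum>a\<in>UNIV. \<Sum>b\<in>UNIV. (J $ a $ i * C $ i $ j * J $ b $ j) *\<^sub>R T a b)"
    by (simp add: scaleR_sum_right mult_ac)
  also have "\<dots> = (\<Sum>a\<in>UNIV. \<Sum>b\<in>UNIV. \<Sum>i\<in>UNIV. \<Sum>j\<in>UNIV. (J $ a $ i * C $ i $ j * J $ b $ j) *\<^sub>R T a b)"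
    by (subst sum_rotate [symmetric], rule sum.cong [OF refl], rule sum_rotate)
  also have "\<dots> = (\<Sum>a\<in>UNIV. \<Sum>b\<in>UNIV. \<Sum>j\<in>UNIV. \<Sum>i\<in>UNIV. (J $ a $ i * C $ i $ j * J $ b $ j) *\<^sub>R T a b)"
    by (rule sum.cong [OF refl], rule sum.cong [OF refl], rule sum.swap)
  also have "\<dots> = (\<Sum>a\<in>UNIV. \<Sum>b\<in>UNIV. (J ** C ** transpose J) $ a $ b *\<^sub>R T a b)"
    by (simp add: matrix_matrix_mult_def transpose_def scaleR_sum_left sum_distrib_right)
  finally show ?thesis .
qed

text \<open>Both vectors are normal, and by the chain rule they differ by a tangent vector: the second
  derivatives of the transition map only contribute combinations of the \<open>pd a y\<close>.\<close>

lemma chart_mean_curvature_transition: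
  fixes x y :: "real^'m \<Rightarrow> real^'n" and \<theta> :: "real^'m \<Rightarrow> real^'m"
  assumes "sphere_chart U x" "sphere_chart V y" and W: "open W" "W \<subseteq> U" "smooth_on W \<theta>"
    and \<theta>: "\<And>w. w \<in> W \<Longrightarrow> \<theta> w \<in> V" "\<And>w. w \<in> W \<Longrightarrow> y (\<theta> w) = x w"
    and u: "u \<in> W"
  shows "chart_mean_curvature x u = chart_mean_curvature y (\<theta> u)"
proof -
  interpret X: sphere_chart U x
    by fact
  interpret Y: sphere_chart V y
    by fact
  have uU: "u \<in> U" and vV: "\<theta> u \<in> V"
    using u W \<theta> by auto
  let ?v = "\<theta> u"
  define J :: "real^'m^'m" where "J = (\<chi> a i. pd i \<theta> u $ a)"
  have d\<theta>: "\<theta> differentiable at w" "pd i \<theta> differentiable at w" if "w \<in> W" for i w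
    using W(3) that smooth_on_imp_differentiable smooth_on_pd by blast+
  have dy: "y differentiable at (\<theta> w)" "pd a y differentiable at (\<theta> w)" if "w \<in> W" for a w
    using Y.smooth_differentiable [OF Y.smooth_x \<theta>(1) [OF that]] by auto
  have pd_x: "pd i x w = (\<Sum>a\<in>UNIV. pd i \<theta> w $ a *\<^sub>R pd a y (\<theta> w))" if "w \<in> W" for i w
    using pd_cong [OF W(1) that, of x "\<lambda>w. y (\<theta> w)" i] pd_chain [OF d\<theta>(1) dy(1), OF that that] \<theta>(2)
    by simp
  have pd_x_u: "pd i x u = (\<Sum>a\<in>UNIV. J $ a $ i *\<^sub>R pd a y ?v)" for i
    using pd_x [OF u] by (simp add: J_def)
  have pd2: "pd i (pd j x) u = (\<Sum>a\<in>UNIV. pd i (pd j \<theta>) u $ a *\<^sub>R pd a y ?v) +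
      (\<Sum>a\<in>UNIV. \<Sum>b\<in>UNIV. (J $ a $ i * J $ b $ j) *\<^sub>R pd a (pd b y) ?v)" for i j
  proof -
    have dn: "(\<lambda>w. pd j \<theta> w $ a) differentiable at u" for a
      by (rule differentiable_bounded_linear [OF bounded_linear_vec_nth d\<theta>(2) [OF u]])
    have dc: "(\<lambda>w. pd a y (\<theta> w)) differentiable at u" for a
      using differentiable_chain_at [OF d\<theta>(1) dy(2), OF u u] by (simp add: comp_def)
    have "pd i (pd j x) u = pd i (\<lambda>w. \<Sum>a\<in>UNIV. pd j \<theta> w $ a *\<^sub>R pd a y (\<theta> w)) u"
      by (rule pd_cong [OF W(1) u pd_x])
    also have "\<dots> = (\<Sum>a\<in>UNIV. pd i (pd j \<theta>) u $ a *\<^sub>R pd a y ?v +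
        pd j \<theta> u $ a *\<^sub>R (\<Sum>b\<in>UNIV. pd i \<theta> u $ b *\<^sub>R pd b (pd a y) ?v))"
      by (simp add: pd_sum differentiable_bilinear [OF bounded_bilinear_scaleR] dn dc pd_scaleR
          pd_bounded_linear [OF bounded_linear_vec_nth d\<theta>(2) [OF u]] pd_chain [OF d\<theta>(1) dy(2), OF u u])
    also have "\<dots> = (\<Sum>a\<in>UNIV. pd i (pd j \<theta>) u $ a *\<^sub>R pd a y ?v) +
        (\<Sum>a\<in>UNIV. \<Sum>b\<in>UNIV. (J $ b $ i * J $ a $ j) *\<^sub>R pd b (pd a y) ?v)"
      by (simp add: sum.distrib scaleR_sum_right J_def mult.commute)
    finally show ?thesis
      by (simp only: sum.swap [of "\<lambda>a b. (J $ b $ i * J $ a $ j) *\<^sub>R pd b (pd a y) ?v"])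
  qed
  have metric: "metric x u = transpose J ** metric y ?v ** J"
  proof -
    have "metric x u $ i $ j = (transpose J ** metric y ?v ** J) $ i $ j" for i j
      unfolding matrix_matrix_mult_def transpose_def metric_def pd_x_u inner_sum_left inner_sum_right
      by (simp add: sum_distrib_left sum_distrib_right mult_ac)
    then show ?thesis
      by (simp add: vec_eq_iff)
  qed
  \<comment> \<open>The kernel of \<open>J\<close> lies in that of \<open>metric x u\<close>, so
    \<open>J\<close> is invertible without recourse to the reverse transition map.\<close>
  have "w = 0" if "J *v w = 0" for w
  proof -
    have "metric x u *v w = 0"
      by (simp add: metric matrix_vector_mul_assoc [symmetric] that)
    then have "(cometric x u ** metric x u) *v w = 0"
      by (simp add: matrix_vector_mul_assoc [symmetric])
    then show ?thesis
      by (simp add: X.cometric_metric [OF uU])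
  qed
  then have "invertible J"
    by (simp add: invertible_left_inverse matrix_left_invertible_ker)
  then obtain K where K: "J ** K = mat 1" "K ** J = mat 1"
    by (auto simp: invertible_def)
  \<comment> \<open>Cancelling \<open>J\<close> on the right exhibits
    \<open>J (cometric x u) J^T\<close> as a left inverse of \<open>metric y ?v\<close>.\<close>
  have "J ** cometric x u ** transpose J ** metric y ?v ** J = J ** (cometric x u ** metric x u)"
    by (simp add: metric matrix_mul_assoc)
  then have "J ** cometric x u ** transpose J ** metric y ?v ** J ** K = J ** K"
    by (simp add: X.cometric_metric [OF uU])
  then have "J ** cometric x u ** transpose J ** metric y ?v = mat 1"
    by (simp add: K matrix_mul_assoc [symmetric])
  then have "J ** cometric x u ** transpose J ** metric y ?v ** cometric y ?v = cometric y ?v"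
    by simp
  then have cometric: "J ** cometric x u ** transpose J = cometric y ?v"
    by (simp add: Y.cometric_metric [OF vV] matrix_mul_assoc [symmetric])
  let ?S = "span (range (\<lambda>a. pd a y ?v))"
  have x_S: "pd i x u \<in> ?S" for i
    unfolding pd_x_u by (intro span_sum span_scale span_base) auto
  have y_S: "pd a y ?v \<in> span (range (\<lambda>i. pd i x u))" for a
  proof -
    have "(\<Sum>i\<in>UNIV. K $ i $ a *\<^sub>R pd i x u) = (\<Sum>b\<in>UNIV. (J ** K) $ b $ a *\<^sub>R pd b y ?v)"
      unfolding pd_x_u scaleR_sum_right
      by (subst sum.swap) (simp add: matrix_matrix_mult_def scaleR_sum_left mult.commute)
    also have "\<dots> = pd a y ?v"
      by (simp add: K mat_def if_distrib if_distribR sum.If_cases cong: if_cong)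
    finally show ?thesis
      by (metis (no_types, lifting) rangeI span_base span_scale span_sum)
  qed
  have trace: "metric_trace x u (\<lambda>i j. \<Sum>a\<in>UNIV. \<Sum>b\<in>UNIV. (J $ a $ i * J $ b $ j) *\<^sub>R pd a (pd b y) ?v) =
      metric_trace y ?v (\<lambda>a b. pd a (pd b y) ?v)"
    unfolding metric_trace_def by (simp add: sum_matrix_transform cometric)
  have "chart_laplacian x x u - chart_laplacian y y ?v =
      metric_trace x u (\<lambda>i j. \<Sum>a\<in>UNIV. pd i (pd j \<theta>) u $ a *\<^sub>R pd a y ?v)
      - metric_trace x u (\<lambda>i j. \<Sum>k\<in>UNIV. christoffel x u k i j *\<^sub>R pd k x u)
      + metric_trace y ?v (\<lambda>i j. \<Sum>k\<in>UNIV. christoffel y ?v k i j *\<^sub>R pd k y ?v)"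
    by (simp add: chart_laplacian_def metric_trace_diff metric_trace_add pd2 trace)
  also have "\<dots> \<in> ?S"
    by (intro span_add span_diff metric_trace_in_span span_sum span_scale x_S) (auto intro: span_base)
  finally have "real CARD('m) *\<^sub>R (chart_mean_curvature x u - chart_mean_curvature y ?v) \<in> ?S"
    by (simp add: X.chart_laplacian_x [OF uU] Y.chart_laplacian_x [OF vV] \<theta>(2) [OF u] algebra_simps)
  then have "(1 / real CARD('m)) *\<^sub>R (real CARD('m) *\<^sub>R (chart_mean_curvature x u - chart_mean_curvature y ?v)) \<in> ?S"
    by (rule span_scale)
  then have diff: "chart_mean_curvature x u - chart_mean_curvature y ?v \<in> ?S"
    by simp
  have "orthogonal (chart_mean_curvature x u) (pd a y ?v)" for a
    by (rule orthogonal_to_span [OF y_S])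
       (use X.mean_curvature_normal(1) [OF uU] in \<open>auto simp: orthogonal_def inner_commute\<close>)
  \<comment> \<open>The difference lies in the common tangent space and is orthogonal to it, hence
    to itself.\<close>
  then have "orthogonal (chart_mean_curvature x u - chart_mean_curvature y ?v)
      (chart_mean_curvature x u - chart_mean_curvature y ?v)"
    using Y.mean_curvature_normal(1) [OF vV]
    by (intro orthogonal_to_span [OF diff]) (auto simp: orthogonal_def inner_diff_left inner_diff_right inner_commute)
  then show ?thesis
    by (simp add: orthogonal_def)
qed


section \<open>Submanifolds of the sphere\<close>

locale sphere_submanifold =
  fixes M :: "('m::finite, 'n::finite) atlas"
  assumes M: "connected_sphere_submanifold M"
begin

section \<open>Charts and smooth maps on the submanifold\<close>

lemma sphere_chart:
  assumes "(U, x) \<in> M"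
  shows "sphere_chart U x"
proof
  show "inj (frechet_derivative x (at u))" if "u \<in> U" for u
    using M assms that by (auto simp: connected_sphere_submanifold_def submanifold_def)
  have "open U \<and> smooth_on U x"
    using M assms by (auto simp: connected_sphere_submanifold_def submanifold_def)
  then show "open U" "smooth_on U x"
    by auto
  show "norm (x u) = 1" if "u \<in> U" for u
  proof -
    have "x u \<in> points M"
      using assms that by (auto simp: points_def)
    then show ?thesis
      using M by (auto simp: connected_sphere_submanifold_def)
  qed
qed

lemma in_points: "(U, x) \<in> M \<Longrightarrow> u \<in> U \<Longrightarrow> x u \<in> points M"
  by (auto simp: points_def)

lemma norm_points: "p \<in> points M \<Longrightarrow> norm p = 1"
  using M by (auto simp: connected_sphere_submanifold_def)

lemma chart_at_point:
  assumes "p \<in> points M"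
  obtains U x u where "(U, x) \<in> M" "u \<in> U" "x u = p" "param_at M p = x" "coord_at M p = u"
proof -
  obtain U x where c: "chart_at M p = (U, x)"
    by fastforce
  have "\<exists>c. case c of (U, x) \<Rightarrow> (U, x) \<in> M \<and> p \<in> x ` U"
    using assms by (auto simp: points_def)
  then have "case chart_at M p of (U, x) \<Rightarrow> (U, x) \<in> M \<and> p \<in> x ` U"
    unfolding chart_at_def by (rule someI_ex)
  then have "(U, x) \<in> M" "p \<in> x ` U"
    by (auto simp: c)
  then show ?thesis
    using that [of U x "inv_into U x p"]
    by (simp add: param_at_def coord_at_def c inv_into_into f_inv_into_f)
qed

lemma transition:
  assumes x: "(U, x) \<in> M" "u \<in> U" and y: "(V, y) \<in> M" "v \<in> V" and eq: "y v = x u"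
  obtains W \<theta> where "open W" "u \<in> W" "W \<subseteq> U" "smooth_on W \<theta>"
    "\<And>w. w \<in> W \<Longrightarrow> \<theta> w \<in> V" "\<And>w. w \<in> W \<Longrightarrow> y (\<theta> w) = x w" "\<theta> u = v"
proof
  let ?W = "{u\<in>U. x u \<in> y ` V}" and ?\<theta> = "inv_into V y \<circ> x"
  show "open ?W" "smooth_on ?W ?\<theta>"
    using M x(1) y(1) unfolding connected_sphere_submanifold_def submanifold_def by blast+
  have inj: "inj_on y V"
    using M y(1) unfolding connected_sphere_submanifold_def submanifold_def by blast
  show "?\<theta> u = v"
    using inv_into_f_f [OF inj y(2)] eq by simp
  show "u \<in> ?W"
    using x(2) y(2) eq by (auto intro: rev_image_eqI)
  show "?\<theta> w \<in> V" "y (?\<theta> w) = x w" if "w \<in> ?W" for w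
    using that by (auto simp: inv_into_into f_inv_into_f)
qed auto

text \<open>This identifies the field, whose chart varies with the point, with a smooth expression
  in one chart, so that it can be differentiated there.\<close>

lemma mean_curvature_vector_chart:
  assumes x: "(U, x) \<in> M" "u \<in> U"
  shows "mean_curvature_vector M (x u) = chart_mean_curvature x u"
proof -
  obtain V y v where y: "(V, y) \<in> M" "v \<in> V" "y v = x u" "param_at M (x u) = y" "coord_at M (x u) = v"
    using chart_at_point in_points x by metis
  obtain W \<theta> where "open W" "u \<in> W" "W \<subseteq> U" "smooth_on W \<theta>"
    "\<And>w. w \<in> W \<Longrightarrow> \<theta> w \<in> V" "\<And>w. w \<in> W \<Longrightarrow> y (\<theta> w) = x w" "\<theta> u = v"
    using transition [OF x y(1-3)] by metis
  then have "chart_mean_curvature x u = chart_mean_curvature y v"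
    using chart_mean_curvature_transition [OF sphere_chart [OF x(1)] sphere_chart [OF y(1)], of W \<theta> u] by simp
  then show ?thesis
    by (simp add: mean_curvature_vector_def Let_def y chart_mean_curvature_def)
qed

lemma smooth_map_chart: "smooth_map M F \<Longrightarrow> (U, x) \<in> M \<Longrightarrow> smooth_on U (\<lambda>w. F (x w))"
  by (auto simp: smooth_map_def comp_def)

lemma smooth_map_ident: "smooth_map M (\<lambda>p. p)"
  using sphere_chart by (auto simp: smooth_map_def comp_def sphere_chart_def)

lemma smooth_map_mean_curvature_vector: "smooth_map M (mean_curvature_vector M)"
  unfolding smooth_map_def
proof clarify
  fix U x assume Ux: "(U, x) \<in> M"
  interpret sphere_chart U x
    by (rule sphere_chart [OF Ux])
  show "smooth_on U (mean_curvature_vector M \<circ> x)"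
    using smooth_on_cong [OF open_U, of "mean_curvature_vector M \<circ> x" "chart_mean_curvature x"]
    by (simp add: mean_curvature_vector_chart [OF Ux] smooth_on_chart_mean_curvature)
qed

lemma smooth_map_const: "smooth_map M (\<lambda>p. c)"
  using sphere_chart by (auto simp: smooth_map_def comp_def sphere_chart_def intro: smooth_on_const)

lemma smooth_map_add: "smooth_map M F \<Longrightarrow> smooth_map M G \<Longrightarrow> smooth_map M (\<lambda>p. F p + G p)"
  using sphere_chart by (fastforce simp: smooth_map_def comp_def sphere_chart_def intro: smooth_on_add)

lemma smooth_map_scaleR:
  assumes "smooth_map M F"
  shows "smooth_map M (\<lambda>p. a *\<^sub>R F p)"
  unfolding smooth_map_def comp_def
  using sphere_chart smooth_map_chart [OF assms]
  by (auto simp: sphere_chart_def intro!: smooth_on_bounded_linear [OF _ bounded_linear_scaleR_right])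

lemma mean_curvature_vector_normal: "p \<in> points M \<Longrightarrow> mean_curvature_vector M p \<bullet> p = 0"
  by (metis chart_at_point mean_curvature_vector_chart sphere_chart sphere_chart.mean_curvature_normal(2) inner_commute)

text \<open>Only the chart chosen at \<open>p\<close> occurs. That is enough, since a Laplacian is
  differentiated again only after it has been rewritten through smooth maps.\<close>

lemma vec_laplacian_chart:
  assumes Ux: "(U, x) \<in> M" "u \<in> U" and p: "param_at M p = x" "coord_at M p = u" and F: "smooth_map M F"
  shows "vec_laplacian M F p = - chart_laplacian x (\<lambda>w. F (x w)) u"
proof -
  interpret sphere_chart U x
    by (rule sphere_chart [OF Ux(1)])
  have "laplacian M (\<lambda>q. F q $ a) p = - chart_laplacian x (\<lambda>w. F (x w) $ a) u" for a
    by (simp add: laplacian_def p hessian_def [abs_def] chart_laplacian_def comp_def)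
  then show ?thesis
    by (simp add: vec_laplacian_def vec_eq_iff
        chart_laplacian_bounded_linear [OF Ux(2) smooth_map_chart [OF F Ux(1)] bounded_linear_vec_nth])
qed

lemma vec_laplacian_cong:
  assumes "p \<in> points M" "smooth_map M F" "smooth_map M G" "\<And>q. q \<in> points M \<Longrightarrow> F q = G q"
  shows "vec_laplacian M F p = vec_laplacian M G p"
proof -
  obtain U x u where x: "(U, x) \<in> M" "u \<in> U" "param_at M p = x" "coord_at M p = u"
    using chart_at_point [OF assms(1)] by metis
  interpret sphere_chart U x
    by (rule sphere_chart [OF x(1)])
  show ?thesis
    unfolding vec_laplacian_chart [OF x assms(2)] vec_laplacian_chart [OF x assms(3)]
    using chart_laplacian_cong [OF x(2), of "\<lambda>w. F (x w)" "\<lambda>w. G (x w)"] assms(4) in_points [OF x(1)]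
    by simp
qed

lemma vec_laplacian_const:
  assumes "p \<in> points M"
  shows "vec_laplacian M (\<lambda>q. c) p = 0"
proof -
  obtain U x u where x: "(U, x) \<in> M" "u \<in> U" "param_at M p = x" "coord_at M p = u"
    using chart_at_point [OF assms(1)] by metis
  interpret sphere_chart U x
    by (rule sphere_chart [OF x(1)])
  show ?thesis
    by (simp add: vec_laplacian_chart [OF x smooth_map_const] chart_laplacian_const)
qed

lemma vec_laplacian_add:
  assumes "p \<in> points M" "smooth_map M F" "smooth_map M G"
  shows "vec_laplacian M (\<lambda>q. F q + G q) p = vec_laplacian M F p + vec_laplacian M G p"
proof -
  obtain U x u where x: "(U, x) \<in> M" "u \<in> U" "param_at M p = x" "coord_at M p = u"
    using chart_at_point [OF assms(1)] by metis
  interpret sphere_chart U x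
    by (rule sphere_chart [OF x(1)])
  show ?thesis
    using chart_laplacian_add [OF x(2) smooth_map_chart [OF assms(2) x(1)] smooth_map_chart [OF assms(3) x(1)]]
    by (simp add: vec_laplacian_chart [OF x] assms smooth_map_add)
qed

lemma vec_laplacian_scaleR:
  assumes "p \<in> points M" "smooth_map M F"
  shows "vec_laplacian M (\<lambda>q. a *\<^sub>R F q) p = a *\<^sub>R vec_laplacian M F p"
proof -
  obtain U x u where x: "(U, x) \<in> M" "u \<in> U" "param_at M p = x" "coord_at M p = u"
    using chart_at_point [OF assms(1)] by metis
  interpret sphere_chart U x
    by (rule sphere_chart [OF x(1)])
  show ?thesis
    using chart_laplacian_bounded_linear [OF x(2) smooth_map_chart [OF assms(2) x(1)] bounded_linear_scaleR_right [of a]]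
    by (simp add: vec_laplacian_chart [OF x] assms smooth_map_scaleR)
qed

lemma vec_laplacian_ident:
  assumes "p \<in> points M"
  shows "vec_laplacian M (\<lambda>q. q) p = real CARD('m) *\<^sub>R (p - mean_curvature_vector M p)"
proof -
  obtain U x u where x: "(U, x) \<in> M" "u \<in> U" "param_at M p = x" "coord_at M p = u" and p: "x u = p"
    using chart_at_point [OF assms(1)] by metis
  interpret sphere_chart U x
    by (rule sphere_chart [OF x(1)])
  show ?thesis
    using mean_curvature_vector_chart [OF x(1,2)]
    by (simp add: vec_laplacian_chart [OF x smooth_map_ident] chart_laplacian_x [OF x(2)] p scaleR_diff_right)
qed

text \<open>The multiple of \<open>p\<close> is the difference of the rough and the componentwise
  Laplacian on normal sections, with \<open>H \<bullet> H\<close> as the square of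
  \<open>f\<close>.\<close>

lemma vec_laplacian_mean_curvature_vector:
  assumes "p \<in> points M" "biharmonic M"
  shows "vec_laplacian M (mean_curvature_vector M) p =
    real CARD('m) *\<^sub>R (mean_curvature_vector M p - (mean_curvature M p)\<^sup>2 *\<^sub>R p)"
proof -
  let ?H = "mean_curvature_vector M"
  obtain U x u where x: "(U, x) \<in> M" "u \<in> U" "param_at M p = x" "coord_at M p = u" and p: "x u = p"
    using chart_at_point [OF assms(1)] by metis
  interpret sphere_chart U x
    by (rule sphere_chart [OF x(1)])
  have H: "?H (x w) = chart_mean_curvature x w" if "w \<in> U" for w
    by (rule mean_curvature_vector_chart [OF x(1) that])
  have Hp: "chart_mean_curvature x u = ?H p"
    using H [OF x(2)] p by simp
  have "metric_trace x u (pullback_nabla2 x (?H \<circ> x) u) =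
      chart_laplacian x (\<lambda>w. ?H (x w)) u - (real CARD('m) * (?H p \<bullet> ?H p)) *\<^sub>R p"
    using metric_trace_pullback_nabla2 [OF x(2) smooth_map_chart [OF smooth_map_mean_curvature_vector x(1)]]
      mean_curvature_normal p H x(2) by (simp add: comp_def Hp)
  then have "rough_laplacian M ?H p =
      vec_laplacian M ?H p + (real CARD('m) * (?H p \<bullet> ?H p)) *\<^sub>R p"
    by (simp add: rough_laplacian_def x vec_laplacian_chart [OF x smooth_map_mean_curvature_vector])
  moreover have "curvature_trace M ?H p = - real CARD('m) *\<^sub>R ?H p"
    using metric_trace_sphere_curvature [OF x(2), of "?H p"] mean_curvature_normal [OF x(2)] H [OF x(2)] p
    by (simp add: curvature_trace_def x)
  moreover have "rough_laplacian M ?H p + curvature_trace M ?H p = 0"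
    using assms by (simp add: biharmonic_def)
  ultimately show ?thesis
    by (simp add: mean_curvature_def power2_norm_eq_inner algebra_simps add_eq_0_iff)
qed

text \<open>The map is locally constant in every chart, so a level set and its complement are both
  open in the manifold topology, the one for which \<open>M\<close> is connected.\<close>

lemma constant_on_points:
  assumes diff: "\<And>U x u. (U, x) \<in> M \<Longrightarrow> u \<in> U \<Longrightarrow> (\<lambda>w. F (x w)) differentiable at u"
    and pd: "\<And>U x u i. (U, x) \<in> M \<Longrightarrow> u \<in> U \<Longrightarrow> pd i (\<lambda>w. F (x w)) u = 0"
  shows "F constant_on points M"
proof (rule ccontr)
  assume "\<not> F constant_on points M"
  then obtain p0 p1 where p01: "p0 \<in> points M" "p1 \<in> points M" "F p1 \<noteq> F p0"
    unfolding constant_on_def by metis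
  have opn: "openin (atlas_topology M) {p\<in>points M. F p \<in> A}" for A
    unfolding openin_atlas_topology
  proof (intro conjI)
    show "\<forall>(U, x)\<in>M. open U \<longrightarrow> open {u\<in>U. x u \<in> {p\<in>points M. F p \<in> A}}"
    proof clarify
      fix U x assume Ux: "(U, x) \<in> M" and U: "open U"
      show "open {u\<in>U. x u \<in> {p\<in>points M. F p \<in> A}}"
        unfolding open_contains_ball
      proof
        fix u assume u: "u \<in> {u\<in>U. x u \<in> {p\<in>points M. F p \<in> A}}"
        then obtain e where e: "e > 0" "ball u e \<subseteq> U"
          using U unfolding open_contains_ball by blast
        have "((\<lambda>w. F (x w)) has_derivative (\<lambda>h. 0)) (at w within ball u e)" if "w \<in> ball u e" for w
        proof (rule has_derivative_at_withinI)
          have "w \<in> U"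
            using that e by auto
          then show "((\<lambda>w. F (x w)) has_derivative (\<lambda>h. 0)) (at w)"
            using has_derivative_pd [OF diff [OF Ux]] by (simp add: pd [OF Ux])
        qed
        then have "\<exists>c. \<forall>w\<in>ball u e. F (x w) = c"
          by (rule has_derivative_zero_constant [OF convex_ball])
        then obtain c where c: "F (x w) = c" if "w \<in> ball u e" for w
          by blast
        have "c \<in> A"
          using u c [of u] e(1) by simp
        then show "\<exists>e>0. ball u e \<subseteq> {u\<in>U. x u \<in> {p\<in>points M. F p \<in> A}}"
          using e c in_points [OF Ux] by (intro exI [of _ e]) auto
      qed
    qed
  qed auto
  have "topspace (atlas_topology M) \<subseteq> points M"
    by (meson openin_atlas_topology openin_topspace)
  moreover have "connected_space (atlas_topology M)"
    using M by (simp add: connected_sphere_submanifold_def)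
  ultimately show False
    using opn [of "{F p0}"] opn [of "- {F p0}"] p01 unfolding connected_space_def by blast
qed

text \<open>Carries a vanishing differential from the chart chosen at the point to any other chart,
  as \<open>constant_on_points\<close> asks for all charts.\<close>

lemma pd_chart_eq_0:
  assumes x: "(U, x) \<in> M" "u \<in> U" and y: "(V, y) \<in> M" "v \<in> V" "y v = x u" and F: "smooth_map M F"
    and zero: "\<And>i. pd i (\<lambda>w. F (y w)) v = 0"
  shows "pd i (\<lambda>w. F (x w)) u = 0"
proof -
  obtain W \<theta> where W: "open W" "u \<in> W" "W \<subseteq> U" "smooth_on W \<theta>"
    "\<And>w. w \<in> W \<Longrightarrow> y (\<theta> w) = x w" "\<theta> u = v"
    using transition [OF x y] by metis
  have "pd i (\<lambda>w. F (x w)) u = pd i (\<lambda>w. F (y (\<theta> w))) u"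
    by (rule pd_cong [OF W(1,2)]) (simp add: W(5))
  also have "\<dots> = (\<Sum>a\<in>UNIV. pd i \<theta> u $ a *\<^sub>R pd a (\<lambda>w. F (y w)) (\<theta> u))"
    by (rule pd_chain)
       (use smooth_on_imp_differentiable [OF W(4,2)]
          smooth_on_imp_differentiable [OF smooth_map_chart [OF F y(1)] y(2)] W(6) in simp_all)
  finally show ?thesis
    by (simp add: W(6) zero)
qed

section \<open>Maps of constant norm\<close>

lemma inner_vec_laplacian:
  assumes F: "smooth_map M F" and const: "\<And>p. p \<in> points M \<Longrightarrow> norm (F p) = c"
    and x: "(U, x) \<in> M" "u \<in> U" "param_at M p = x" "coord_at M p = u" "x u = p"
  shows "F p \<bullet> vec_laplacian M F p =
    metric_trace x u (\<lambda>i j. pd i (\<lambda>w. F (x w)) u \<bullet> pd j (\<lambda>w. F (x w)) u)"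
proof -
  interpret sphere_chart U x
    by (rule sphere_chart [OF x(1)])
  have "F (x w) \<bullet> F (x w) = c\<^sup>2" if "w \<in> U" for w
    using const [OF in_points [OF x(1) that]] by (simp add: power2_norm_eq_inner [symmetric])
  then show ?thesis
    using inner_chart_laplacian_of_norm_const [OF x(2) smooth_map_chart [OF F x(1)]]
    by (simp add: vec_laplacian_chart [OF x(1-4) F] x(5))
qed

lemma inner_vec_laplacian_nonneg:
  assumes "smooth_map M F" and "\<And>p. p \<in> points M \<Longrightarrow> norm (F p) = c" and "p \<in> points M"
  shows "F p \<bullet> vec_laplacian M F p \<ge> 0"
proof -
  obtain U x u where x: "(U, x) \<in> M" "u \<in> U" "param_at M p = x" "coord_at M p = u" "x u = p"
    using chart_at_point [OF assms(3)] by metis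
  interpret sphere_chart U x
    by (rule sphere_chart [OF x(1)])
  show ?thesis
    by (simp add: inner_vec_laplacian [OF assms(1,2) x] metric_trace_inner_nonneg [OF x(2)])
qed

lemma constant_if_inner_vec_laplacian_eq_0:
  assumes F: "smooth_map M F" and const: "\<And>p. p \<in> points M \<Longrightarrow> norm (F p) = c"
    and zero: "\<And>p. p \<in> points M \<Longrightarrow> F p \<bullet> vec_laplacian M F p = 0"
  shows "F constant_on points M"
proof (rule constant_on_points)
  fix U x u i assume x: "(U, x) \<in> M" "u \<in> U"
  show "(\<lambda>w. F (x w)) differentiable at u"
    by (rule smooth_on_imp_differentiable [OF smooth_map_chart [OF F x(1)] x(2)])
  have p: "x u \<in> points M"
    by (rule in_points [OF x])
  obtain V y v where y: "(V, y) \<in> M" "v \<in> V" "param_at M (x u) = y" "coord_at M (x u) = v" "y v = x u"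
    using chart_at_point [OF p] by metis
  interpret sphere_chart V y
    by (rule sphere_chart [OF y(1)])
  have "pd i (\<lambda>w. F (y w)) v = 0" for i
    by (rule metric_trace_inner_eq_0 [OF y(2)])
       (use inner_vec_laplacian [OF F const y] zero [OF p] in simp)
  then show "pd i (\<lambda>w. F (x w)) u = 0"
    by (rule pd_chart_eq_0 [OF x y(1,2,5) F])
qed

lemma eigenmap_neq_0:
  assumes "eigenmap M l F"
  obtains p where "p \<in> points M" "F p \<noteq> 0"
  using assms unfolding eigenmap_def constant_on_def by metis

text \<open>For \<open>l \<noteq> 0\<close> it suffices that \<open>F\<close> is nonzero somewhere:
  a constant map has Laplacian 0, hence would satisfy \<open>l F = 0\<close>.\<close>

lemma eigenmapI:
  assumes F: "smooth_map M F" and lap: "\<And>p. p \<in> points M \<Longrightarrow> vec_laplacian M F p = l *\<^sub>R F p"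
    and "l \<noteq> 0" and p: "p \<in> points M" "F p \<noteq> 0"
  shows "eigenmap M l F"
proof -
  have "\<not> F constant_on points M"
  proof
    assume "F constant_on points M"
    then obtain c where "\<And>q. q \<in> points M \<Longrightarrow> F q = c"
      unfolding constant_on_def by blast
    then have "vec_laplacian M F p = vec_laplacian M (\<lambda>q. c) p"
      by (intro vec_laplacian_cong p F smooth_map_const)
    then show False
      using lap [OF p(1)] \<open>l \<noteq> 0\<close> p by (simp add: vec_laplacian_const)
  qed
  with F lap show ?thesis
    by (simp add: eigenmap_def)
qed

lemma vec_laplacian_lincomb:
  assumes "p \<in> points M" "smooth_map M F" "smooth_map M G"
  shows "vec_laplacian M (\<lambda>q. a *\<^sub>R F q + b *\<^sub>R G q) p = a *\<^sub>R vec_laplacian M F p + b *\<^sub>R vec_laplacian M G p"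
  using assms by (simp add: vec_laplacian_add vec_laplacian_scaleR smooth_map_scaleR)

lemma smooth_map_lincomb:
  "smooth_map M F \<Longrightarrow> smooth_map M G \<Longrightarrow> smooth_map M (\<lambda>q. a *\<^sub>R F q + b *\<^sub>R G q)"
  by (intro smooth_map_add smooth_map_scaleR)

end


section \<open>Proper biharmonic submanifolds and their type\<close>

locale proper_biharmonic_submanifold = sphere_submanifold M for M :: "('m::finite, 'n::finite) atlas" +
  fixes m :: real
  assumes proper: "proper_biharmonic M"
    and m: "m = real CARD('m)"
begin

abbreviation "H \<equiv> mean_curvature_vector M"
abbreviation "f \<equiv> mean_curvature M"

lemma m_pos [simp]: "m > 0" "m \<noteq> 0"
  by (simp_all add: m)

lemma lap_ident: "p \<in> points M \<Longrightarrow> vec_laplacian M (\<lambda>q. q) p = m *\<^sub>R (p - H p)"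
  by (simp add: vec_laplacian_ident m)

lemma lap_H: "p \<in> points M \<Longrightarrow> vec_laplacian M H p = m *\<^sub>R (H p - (f p)\<^sup>2 *\<^sub>R p)"
  using vec_laplacian_mean_curvature_vector proper by (simp add: proper_biharmonic_def m)

lemma H_inner_H: "H p \<bullet> H p = (f p)\<^sup>2"
  by (simp add: mean_curvature_def power2_norm_eq_inner)

text \<open>Besides excluding \<open>f = 0\<close>, this supplies a point of \<open>M\<close> for
  the constructions below.\<close>

lemma not_minimal: obtains p where "p \<in> points M" "f p \<noteq> 0"
  using proper by (auto simp: proper_biharmonic_def minimal_def mean_curvature_def)

lemma inner_self: "p \<in> points M \<Longrightarrow> p \<bullet> p = 1"
  using norm_points by (simp add: norm_eq_1)

lemma lincomb_const_mean_curvature: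
  assumes "p \<in> points M" "f p = c"
  shows "vec_laplacian M (\<lambda>q. a *\<^sub>R q + b *\<^sub>R H q) p = (m * (a - b * c\<^sup>2)) *\<^sub>R p + (m * (b - a)) *\<^sub>R H p"
  using assms
  by (simp add: vec_laplacian_lincomb smooth_map_ident smooth_map_mean_curvature_vector
      lap_ident lap_H algebra_simps)

lemma inner_laplacian_ident_plus_H:
  assumes "p \<in> points M" "f p = c"
  shows "(p + H p) \<bullet> vec_laplacian M (\<lambda>q. q + H q) p = m * (1 - c\<^sup>2)"
  using lincomb_const_mean_curvature [OF assms, of 1 1] mean_curvature_vector_normal [OF assms(1)] inner_self [OF assms(1)]
  by (simp add: inner_add_left inner_add_right)

lemma norm_ident_plus_H:
  assumes "p \<in> points M" "f p = c"
  shows "norm (p + H p) = sqrt (1 + c\<^sup>2)"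
  using mean_curvature_vector_normal [OF assms(1)] inner_self [OF assms(1)] H_inner_H [of p] assms(2)
  by (simp add: norm_eq_sqrt_inner inner_add_left inner_add_right inner_commute)

lemma smooth_ident_plus_H: "smooth_map M (\<lambda>q. q + H q)"
  by (intro smooth_map_add smooth_map_ident smooth_map_mean_curvature_vector)

lemma const_mean_curvature_bounds:
  assumes c: "\<And>p. p \<in> points M \<Longrightarrow> f p = c"
  shows "0 < c" "c \<le> 1"
proof -
  obtain p where p: "p \<in> points M" "f p \<noteq> 0"
    using not_minimal .
  have "f p \<ge> 0"
    by (simp add: mean_curvature_def)
  then show "0 < c"
    using p c by force
  have "m * (1 - c\<^sup>2) \<ge> 0"
    using inner_vec_laplacian_nonneg [OF smooth_ident_plus_H norm_ident_plus_H [OF _ c] p(1)]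
      inner_laplacian_ident_plus_H [OF p(1) c [OF p(1)]] by simp
  then have "c\<^sup>2 \<le> 1\<^sup>2"
    using m_pos(1) by (auto simp: zero_le_mult_iff)
  then show "c \<le> 1"
    by (rule power2_le_imp_le) simp
qed

lemma mean_curvature_1:
  assumes f: "\<And>p. p \<in> points M \<Longrightarrow> f p = 1"
  obtains \<phi>\<^sub>0 where "\<And>p. p \<in> points M \<Longrightarrow> H p = 2 *\<^sub>R \<phi>\<^sub>0 - p"
    and "norm \<phi>\<^sub>0 = 1 / sqrt 2" and "eigenmap M (2 * m) (\<lambda>p. p - \<phi>\<^sub>0)"
proof -
  obtain p0 where p0: "p0 \<in> points M"
    using not_minimal by metis
  have "(\<lambda>q. q + H q) constant_on points M"
    by (rule constant_if_inner_vec_laplacian_eq_0 [OF smooth_ident_plus_H norm_ident_plus_H [OF _ f]])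
       (simp_all add: inner_laplacian_ident_plus_H [OF _ f])
  then obtain c where c: "\<And>p. p \<in> points M \<Longrightarrow> p + H p = c"
    unfolding constant_on_def by metis
  \<comment> \<open>Half of the constant \<open>p + H\<close>, whose norm is \<open>sqrt 2\<close>.
    Then \<open>p - H\<close> is twice \<open>p - \<phi>\<^sub>0\<close>, so the Laplacian of
    \<open>p\<close>, which is \<open>m (p - H)\<close>, gives the eigenvalue
    \<open>2 m\<close>.\<close>
  define \<phi>\<^sub>0 where "\<phi>\<^sub>0 = (1 / 2) *\<^sub>R c"
  have H: "H p = 2 *\<^sub>R \<phi>\<^sub>0 - p" if "p \<in> points M" for p
    using c [OF that] by (simp add: \<phi>\<^sub>0_def algebra_simps)
  have half: "p - H p = 2 *\<^sub>R (p - \<phi>\<^sub>0)" if "p \<in> points M" for p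
    by (simp add: H [OF that] scaleR_2)
  have norm: "norm \<phi>\<^sub>0 = 1 / sqrt 2"
    using norm_ident_plus_H [OF p0 f [OF p0]] c [OF p0] by (simp add: \<phi>\<^sub>0_def real_div_sqrt field_simps)
  have smooth: "smooth_map M (\<lambda>p. p - \<phi>\<^sub>0)"
    using smooth_map_add [OF smooth_map_ident smooth_map_const [of "- \<phi>\<^sub>0"]] by simp
  have "eigenmap M (2 * m) (\<lambda>p. p - \<phi>\<^sub>0)"
  proof (rule eigenmapI [OF smooth _ _ p0])
    show "vec_laplacian M (\<lambda>p. p - \<phi>\<^sub>0) p = (2 * m) *\<^sub>R (p - \<phi>\<^sub>0)" if p: "p \<in> points M" for p
      using vec_laplacian_add [OF p smooth_map_ident smooth_map_const [of "- \<phi>\<^sub>0"]]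
        half [OF p]
      by (simp add: vec_laplacian_const [OF p] lap_ident [OF p] mult.commute)
    show "p0 - \<phi>\<^sub>0 \<noteq> 0"
    proof
      assume "p0 - \<phi>\<^sub>0 = 0"
      then have "1 = 1 / sqrt 2"
        using norm norm_points [OF p0] by simp
      then show False
        by (simp add: field_simps)
    qed
  qed simp
  then show thesis
    using that H norm by blast
qed

lemma finite_type_1_if:
  assumes "\<And>p. p \<in> points M \<Longrightarrow> p = c + F p" "eigenmap M l F"
  shows "finite_type 1 M"
  unfolding finite_type_def
  by (rule exI [of _ c], rule exI [of _ "\<lambda>_. F"], rule exI [of _ "\<lambda>_. l"]) (use assms in \<open>auto simp: inj_on_def\<close>)

text \<open>Type 1 makes \<open>H\<close> an affine function of \<open>p\<close>, which gives a
  second expression for the Laplacian of \<open>H\<close>. Comparing it with the biharmonic one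
  determines \<open>f\<close> pointwise.\<close>

lemma finite_type_1_imp:
  assumes "finite_type 1 M" and p: "p \<in> points M"
  shows "f p = 1"
proof -
  obtain c F l where F: "eigenmap M l F" and eq: "\<And>p. p \<in> points M \<Longrightarrow> p = c + F p"
    using assms(1) unfolding finite_type_def by auto
  have smooth: "smooth_map M F" and lap: "\<And>p. p \<in> points M \<Longrightarrow> vec_laplacian M F p = l *\<^sub>R F p"
    using F by (auto simp: eigenmap_def)
  have H: "m *\<^sub>R (q - H q) = l *\<^sub>R (q - c)" if q: "q \<in> points M" for q
  proof -
    have "vec_laplacian M (\<lambda>q. q) q = vec_laplacian M (\<lambda>q. c + F q) q"
      by (rule vec_laplacian_cong [OF q smooth_map_ident smooth_map_add [OF smooth_map_const smooth] eq])
    also have "\<dots> = l *\<^sub>R F q"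
      by (simp add: vec_laplacian_add [OF q smooth_map_const smooth] vec_laplacian_const [OF q] lap [OF q])
    also have "F q = q - c"
      using eq [OF q] by (simp add: algebra_simps)
    finally show ?thesis
      by (simp add: lap_ident [OF q])
  qed
  define \<alpha> where "\<alpha> = 1 - l / m"
  have H_eq: "H q = \<alpha> *\<^sub>R q + (l / m) *\<^sub>R c" if "q \<in> points M" for q
  proof -
    have "q - H q = (1 / m) *\<^sub>R (m *\<^sub>R (q - H q))"
      by simp
    also have "\<dots> = (l / m) *\<^sub>R (q - c)"
      by (simp only: H [OF that]) simp
    finally show ?thesis
      by (simp add: \<alpha>_def algebra_simps)
  qed
  have key: "m *\<^sub>R (H q - (f q)\<^sup>2 *\<^sub>R q) = (\<alpha> * m) *\<^sub>R (q - H q)" if q: "q \<in> points M" for q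
  proof -
    have "vec_laplacian M H q = vec_laplacian M (\<lambda>q. \<alpha> *\<^sub>R q + (l / m) *\<^sub>R c) q"
      by (intro vec_laplacian_cong q smooth_map_mean_curvature_vector H_eq
          smooth_map_add smooth_map_scaleR smooth_map_ident smooth_map_const)
    then show ?thesis
      by (simp add: vec_laplacian_lincomb [OF q smooth_map_ident smooth_map_const]
          lap_ident [OF q] vec_laplacian_const [OF q] lap_H [OF q])
  qed
  \<comment> \<open>The inner products of \<open>key\<close> with the orthogonal vectors
    \<open>q\<close> and \<open>H q\<close>. A point with \<open>f \<noteq> 0\<close> then forces
    \<open>\<alpha> = - 1\<close>.\<close>
  have *: "(f q)\<^sup>2 = - \<alpha>" "(f q)\<^sup>2 * (1 + \<alpha>) = 0" if q: "q \<in> points M" for q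
  proof -
    have "q \<bullet> (m *\<^sub>R (H q - (f q)\<^sup>2 *\<^sub>R q)) = q \<bullet> ((\<alpha> * m) *\<^sub>R (q - H q))"
      and "H q \<bullet> (m *\<^sub>R (H q - (f q)\<^sup>2 *\<^sub>R q)) = H q \<bullet> ((\<alpha> * m) *\<^sub>R (q - H q))"
      by (simp_all only: key [OF q])
    then have "m * (f q)\<^sup>2 = m * - \<alpha>" "m * ((f q)\<^sup>2 * (1 + \<alpha>)) = 0"
      using mean_curvature_vector_normal [OF q] inner_self [OF q] H_inner_H [of q]
      by (simp_all add: inner_diff_right inner_commute algebra_simps)
    then show "(f q)\<^sup>2 = - \<alpha>" "(f q)\<^sup>2 * (1 + \<alpha>) = 0"
      by (simp_all only: mult_cancel_left mult_eq_0_iff m_pos(2) simp_thms)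
  qed
  obtain p0 where "p0 \<in> points M" "f p0 \<noteq> 0"
    using not_minimal .
  then have "\<alpha> = - 1"
    using *(2) [of p0] by simp
  then have "(f p)\<^sup>2 = 1"
    using *(1) [OF p] by simp
  moreover have "f p \<ge> 0"
    by (simp add: mean_curvature_def)
  ultimately show ?thesis
    by (simp add: power2_eq_1_iff)
qed

text \<open>The sign \<open>s\<close> selects the eigenvector \<open>p + (s / c) H\<close>, an
  eigenvector because \<open>s^2 = 1\<close>; the factor \<open>1 / 2\<close> makes the two parts
  add up to \<open>p\<close>.\<close>

lemma eigenmap_decomposition:
  assumes f: "\<And>p. p \<in> points M \<Longrightarrow> f p = c" and c: "0 < c" "c < 1" and s: "s = 1 \<or> s = - 1"
  shows "eigenmap M (m * (1 - s * c)) (\<lambda>p. (1 / 2) *\<^sub>R p + (s / (2 * c)) *\<^sub>R H p)"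
proof -
  obtain p0 where p0: "p0 \<in> points M"
    using not_minimal by metis
  show ?thesis
  proof (rule eigenmapI [OF _ _ _ p0])
    show "smooth_map M (\<lambda>p. (1 / 2) *\<^sub>R p + (s / (2 * c)) *\<^sub>R H p)"
      by (rule smooth_map_lincomb [OF smooth_map_ident smooth_map_mean_curvature_vector])
    show "vec_laplacian M (\<lambda>p. (1 / 2) *\<^sub>R p + (s / (2 * c)) *\<^sub>R H p) p =
        (m * (1 - s * c)) *\<^sub>R ((1 / 2) *\<^sub>R p + (s / (2 * c)) *\<^sub>R H p)" if p: "p \<in> points M" for p
    proof -
      have "m * (1 / 2 - s / (2 * c) * c\<^sup>2) = m * (1 - s * c) * (1 / 2)"
        using c by (simp add: field_simps power2_eq_square)
      moreover have "m * (s / (2 * c) - 1 / 2) = m * (1 - s * c) * (s / (2 * c))"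
        using c s by (auto simp: field_simps)
      ultimately show ?thesis
        unfolding lincomb_const_mean_curvature [OF p f [OF p]]
        by (simp only: scaleR_add_right scaleR_scaleR)
    qed
    \<comment> \<open>Here \<open>c < 1\<close> enters: at \<open>c = 1\<close> the part for
      \<open>s = 1\<close> would be constant.\<close>
    show "m * (1 - s * c) \<noteq> 0"
      using s c by auto
    show "(1 / 2) *\<^sub>R p0 + (s / (2 * c)) *\<^sub>R H p0 \<noteq> 0"
    proof
      assume "(1 / 2) *\<^sub>R p0 + (s / (2 * c)) *\<^sub>R H p0 = 0"
      then have "((1 / 2) *\<^sub>R p0 + (s / (2 * c)) *\<^sub>R H p0) \<bullet> p0 = 0"
        by simp
      then show False
        by (simp add: inner_add_left inner_self [OF p0] mean_curvature_vector_normal [OF p0])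
    qed
  qed
qed

lemma ident_decomposition:
  "c \<noteq> 0 \<Longrightarrow> p = ((1 / 2) *\<^sub>R p + (1 / (2 * c)) *\<^sub>R H p) + ((1 / 2) *\<^sub>R p + (- 1 / (2 * c)) *\<^sub>R H p)"
  by (simp add: scaleR_add_left [symmetric])

lemma finite_type_2_if:
  assumes f: "\<And>p. p \<in> points M \<Longrightarrow> f p = c" and c: "0 < c" "c < 1"
  shows "finite_type 2 M"
proof -
  define s where "s t = (if t = 0 then 1 else - 1 :: real)" for t :: nat
  define F where "F t p = (1 / 2) *\<^sub>R p + (s t / (2 * c)) *\<^sub>R H p" for t p
  have "eigenmap M (m * (1 - s t * c)) (F t)" for t
    unfolding F_def by (rule eigenmap_decomposition [OF f c]) (auto simp: s_def)
  moreover have "inj_on (\<lambda>t. m * (1 - s t * c)) {..<2}"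
    using c by (auto simp: inj_on_def s_def split: if_splits)
  moreover have "p = 0 + (\<Sum>t<2. F t p)" for p
    using ident_decomposition [of c p] c by (simp add: F_def s_def numeral_2_eq_2)
  ultimately show ?thesis
    unfolding finite_type_def by blast
qed

text \<open>One and two applications of the Laplacian to \<open>p = c + F + G\<close>. The second is
  applied to \<open>m (p - H)\<close>, where biharmonicity evaluates it.\<close>

lemma two_type_laplacians:
  assumes F: "eigenmap M l F" and G: "eigenmap M k G"
    and eq: "\<And>p. p \<in> points M \<Longrightarrow> p = c + F p + G p" and p: "p \<in> points M"
  shows "m *\<^sub>R (p - H p) = l *\<^sub>R F p + k *\<^sub>R G p"
    and "m\<^sup>2 *\<^sub>R ((1 + (f p)\<^sup>2) *\<^sub>R p - 2 *\<^sub>R H p) = l\<^sup>2 *\<^sub>R F p + k\<^sup>2 *\<^sub>R G p"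
proof -
  have smooth: "smooth_map M F" "smooth_map M G"
    and lap: "\<And>p. p \<in> points M \<Longrightarrow> vec_laplacian M F p = l *\<^sub>R F p"
      "\<And>p. p \<in> points M \<Longrightarrow> vec_laplacian M G p = k *\<^sub>R G p"
    using F G by (auto simp: eigenmap_def)
  have 1: "m *\<^sub>R (q - H q) = l *\<^sub>R F q + k *\<^sub>R G q" if q: "q \<in> points M" for q
  proof -
    have "vec_laplacian M (\<lambda>q. q) q = vec_laplacian M (\<lambda>q. c + F q + G q) q"
      by (intro vec_laplacian_cong q smooth_map_ident smooth_map_add smooth_map_const smooth eq)
    then show ?thesis
      by (simp add: vec_laplacian_add [OF q] smooth_map_add smooth_map_const smooth
          vec_laplacian_const [OF q] lap [OF q] lap_ident [OF q])
  qed
  show "m *\<^sub>R (p - H p) = l *\<^sub>R F p + k *\<^sub>R G p"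
    by (rule 1 [OF p])
  have "vec_laplacian M (\<lambda>q. m *\<^sub>R q + (- m) *\<^sub>R H q) p = vec_laplacian M (\<lambda>q. l *\<^sub>R F q + k *\<^sub>R G q) p"
    by (intro vec_laplacian_cong p smooth_map_lincomb smooth_map_ident smooth_map_mean_curvature_vector smooth)
       (simp add: 1 [symmetric] scaleR_diff_right)
  also have "\<dots> = l\<^sup>2 *\<^sub>R F p + k\<^sup>2 *\<^sub>R G p"
    by (simp add: vec_laplacian_lincomb [OF p] smooth lap [OF p] power2_eq_square)
  finally show "m\<^sup>2 *\<^sub>R ((1 + (f p)\<^sup>2) *\<^sub>R p - 2 *\<^sub>R H p) = l\<^sup>2 *\<^sub>R F p + k\<^sup>2 *\<^sub>R G p"
    \<comment> \<open>Only the value of \<open>f\<close> at \<open>p\<close> enters, so constancy of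
      \<open>f\<close> is not presupposed.\<close>
    unfolding lincomb_const_mean_curvature [OF p refl]
    by (simp add: algebra_simps power2_eq_square)
qed

lemma finite_type_2E:
  assumes "finite_type 2 M"
  obtains c F G l k where "l \<noteq> k" "eigenmap M l F" "eigenmap M k G"
    "\<And>p. p \<in> points M \<Longrightarrow> p = c + F p + G p"
proof -
  obtain c F l where "inj_on l {..<2::nat}" "\<forall>t<2. eigenmap M (l t) (F t)"
    "\<forall>p\<in>points M. p = c + (\<Sum>t<2. F t p)"
    using assms unfolding finite_type_def by metis
  then show ?thesis
    using that [of "l 0" "l 1" "F 0" "F 1" c]
    by (auto simp: numeral_2_eq_2 inj_on_def add_ac)
qed

text \<open>Eliminating both eigenmaps leaves a linear relation between the position vector, the mean
  curvature vector and a constant vector. Its tangential part says that the constant vector is normal,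
  so its radial part, which determines the mean curvature, has zero derivative.\<close>

lemma finite_type_2_const_mean_curvature:
  assumes "finite_type 2 M"
  obtains a where "\<And>p. p \<in> points M \<Longrightarrow> f p = a"
proof -
  obtain c F G l k where F: "eigenmap M l F" and G: "eigenmap M k G"
    and eq: "\<And>p. p \<in> points M \<Longrightarrow> p = c + F p + G p"
    using finite_type_2E [OF assms] by metis
  \<comment> \<open>The coefficients of \<open>(\<Delta> - l) (\<Delta> - k) p\<close>, expanded in
    \<open>p\<close> and \<open>H\<close>. This operator annihilates \<open>F\<close> and
    \<open>G\<close> and multiplies the constant \<open>c\<close> by \<open>l k\<close>.\<close>
  define b where "b = m\<^sup>2 - (l + k) * m + l * k"
  define d where "d = (l + k) * m - 2 * m\<^sup>2"
  define v where "v = (l * k) *\<^sub>R c"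
  have rel: "(m\<^sup>2 * (f p)\<^sup>2 + b) *\<^sub>R p + d *\<^sub>R H p = v" if p: "p \<in> points M" for p
  proof -
    have "c = p - F p - G p"
      using eq [OF p] by (simp add: algebra_simps)
    then have v: "v = (l * k) *\<^sub>R p - (l * k) *\<^sub>R F p - (l * k) *\<^sub>R G p"
      by (simp add: v_def scaleR_diff_right)
    have "(m\<^sup>2 * (f p)\<^sup>2 + b) *\<^sub>R p + d *\<^sub>R H p =
        m\<^sup>2 *\<^sub>R ((1 + (f p)\<^sup>2) *\<^sub>R p - 2 *\<^sub>R H p) - (l + k) *\<^sub>R (m *\<^sub>R (p - H p)) + (l * k) *\<^sub>R p"
      by (simp add: b_def d_def algebra_simps)
    also have "\<dots> = (l\<^sup>2 *\<^sub>R F p + k\<^sup>2 *\<^sub>R G p) - (l + k) *\<^sub>R (l *\<^sub>R F p + k *\<^sub>R G p) + (l * k) *\<^sub>R p"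
      using two_type_laplacians [OF F G eq p] by simp
    also have "\<dots> = v"
      unfolding v by (simp add: algebra_simps power2_eq_square)
    finally show ?thesis .
  qed
  have radial: "m\<^sup>2 * (f p)\<^sup>2 + b = v \<bullet> p" if "p \<in> points M" for p
    unfolding rel [OF that, symmetric]
    by (simp add: inner_add_left inner_self [OF that] mean_curvature_vector_normal [OF that])
  have "(\<lambda>p. v \<bullet> p) constant_on points M"
  proof (rule constant_on_points)
    fix U x u i assume x: "(U, x) \<in> M" "u \<in> U"
    interpret sphere_chart U x
      by (rule sphere_chart [OF x(1)])
    have dx: "x differentiable at u"
      by (rule smooth_differentiable [OF smooth_x x(2)])
    show "(\<lambda>w. v \<bullet> x w) differentiable at u"
      by (rule differentiable_bounded_linear [OF bounded_linear_inner_right dx])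
    have "pd i (\<lambda>w. v \<bullet> x w) u = v \<bullet> pd i x u"
      by (rule pd_bounded_linear [OF bounded_linear_inner_right dx])
    also have "\<dots> = 0"
      unfolding rel [OF in_points [OF x], symmetric]
      using x_inner_pd [OF x(2)] mean_curvature_normal(1) [OF x(2)] mean_curvature_vector_chart [OF x]
      by (simp add: inner_add_left inner_add_right inner_commute)
    finally show "pd i (\<lambda>w. v \<bullet> x w) u = 0" .
  qed
  then obtain e where e: "\<And>p. p \<in> points M \<Longrightarrow> v \<bullet> p = e"
    unfolding constant_on_def by metis
  have "f p = sqrt ((e - b) / m\<^sup>2)" if "p \<in> points M" for p
  proof -
    have "(f p)\<^sup>2 = (e - b) / m\<^sup>2"
      using radial [OF that] e [OF that] by (simp add: field_simps)
    then show ?thesis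
      by (metis mean_curvature_def norm_ge_zero real_sqrt_unique)
  qed
  then show ?thesis
    by (rule that)
qed

text \<open>For \<open>f = 1\<close> the position vector satisfies
  \<open>\<Delta> (\<Delta> - 2 m) p = 0\<close>, so the two eigenvalues can only be 0 and
  \<open>2 m\<close>. The part for \<open>2 m\<close> is then \<open>p - \<phi>\<^sub>0\<close>,
  which leaves a constant for eigenvalue 0.\<close>

lemma finite_type_2_mean_curvature_neq_1:
  assumes f: "\<And>p. p \<in> points M \<Longrightarrow> f p = 1"
  shows "\<not> finite_type 2 M"
proof
  assume "finite_type 2 M"
  then obtain c F G l k where lk: "l \<noteq> k" and F: "eigenmap M l F" and G: "eigenmap M k G"
    and eq: "\<And>p. p \<in> points M \<Longrightarrow> p = c + F p + G p"
    using finite_type_2E by metis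
  obtain \<phi>\<^sub>0 where H: "\<And>p. p \<in> points M \<Longrightarrow> H p = 2 *\<^sub>R \<phi>\<^sub>0 - p"
    and \<phi>: "eigenmap M (2 * m) (\<lambda>p. p - \<phi>\<^sub>0)"
    using mean_curvature_1 [OF f] by metis
  have impossible: False if F: "eigenmap M l F" and G: "eigenmap M k G" and lk: "l \<noteq> k"
    and eq: "\<And>p. p \<in> points M \<Longrightarrow> p = c + F p + G p" and k: "k * (k - 2 * m) = 0" and "l = 0"
    for F G l k
  proof -
    have k: "k = 2 * m"
      using k lk \<open>l = 0\<close> by auto
    have "F p = \<phi>\<^sub>0 - c" if p: "p \<in> points M" for p
    proof -
      have "(2 * m) *\<^sub>R G p = m *\<^sub>R (p - H p)"
        using two_type_laplacians(1) [OF F G eq p] by (simp add: k \<open>l = 0\<close>)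
      also have "\<dots> = (2 * m) *\<^sub>R (p - \<phi>\<^sub>0)"
        using H [OF p] by (simp add: scaleR_2 flip: scaleR_scaleR)
      finally have "G p = p - \<phi>\<^sub>0"
        by simp
      then have "p - G p = \<phi>\<^sub>0"
        by (simp add: diff_eq_eq)
      moreover have "p - G p = c + F p"
        using eq [OF p] by (metis add_diff_cancel_right')
      ultimately show ?thesis
        by (simp add: eq_diff_eq add.commute)
    qed
    then have "F constant_on points M"
      unfolding constant_on_def by blast
    then show False
      using F by (simp add: eigenmap_def)
  qed
  have root: "l * (l - 2 * m) = 0" if F: "eigenmap M l F" and G: "eigenmap M k G" and lk: "l \<noteq> k"
    and eq: "\<And>p. p \<in> points M \<Longrightarrow> p = c + F p + G p" for F G l k
  proof -
    have smooth: "smooth_map M F" "smooth_map M G"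
      and lap: "\<And>p. p \<in> points M \<Longrightarrow> vec_laplacian M F p = l *\<^sub>R F p"
        "\<And>p. p \<in> points M \<Longrightarrow> vec_laplacian M G p = k *\<^sub>R G p"
      using F G by (auto simp: eigenmap_def)
    have 1: "(l * (l - 2 * m)) *\<^sub>R F q + (k * (k - 2 * m)) *\<^sub>R G q = 0" if q: "q \<in> points M" for q
    proof -
      have "l\<^sup>2 *\<^sub>R F q + k\<^sup>2 *\<^sub>R G q = m\<^sup>2 *\<^sub>R ((1 + (f q)\<^sup>2) *\<^sub>R q - 2 *\<^sub>R H q)"
        using two_type_laplacians(2) [OF F G eq q] by simp
      also have "\<dots> = (2 * m) *\<^sub>R (m *\<^sub>R (q - H q))"
        by (simp add: f [OF q] algebra_simps power2_eq_square)
      also have "\<dots> = (2 * m) *\<^sub>R (l *\<^sub>R F q + k *\<^sub>R G q)"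
        using two_type_laplacians(1) [OF F G eq q] by simp
      finally have "l\<^sup>2 *\<^sub>R F q + k\<^sup>2 *\<^sub>R G q = (2 * m) *\<^sub>R (l *\<^sub>R F q + k *\<^sub>R G q)" .
      then show ?thesis
        by (simp add: algebra_simps power2_eq_square)
    qed
    obtain p where p: "p \<in> points M" "F p \<noteq> 0"
      using eigenmap_neq_0 [OF F] .
    \<comment> \<open>The Laplacian multiplies the two terms of relation \<open>1\<close> by
      \<open>l\<close> and \<open>k\<close>; subtracting \<open>k\<close> times the relation
      eliminates \<open>G\<close>.\<close>
    have "vec_laplacian M (\<lambda>q. (l * (l - 2 * m)) *\<^sub>R F q + (k * (k - 2 * m)) *\<^sub>R G q) p = vec_laplacian M (\<lambda>q. 0) p"
      by (intro vec_laplacian_cong p smooth_map_lincomb smooth_map_const smooth 1)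
    then have "l *\<^sub>R (l * (l - 2 * m)) *\<^sub>R F p + k *\<^sub>R (k * (k - 2 * m)) *\<^sub>R G p = 0"
      by (simp add: vec_laplacian_lincomb [OF p(1)] smooth lap [OF p(1)] vec_laplacian_const [OF p(1)] mult_ac)
    moreover have "k *\<^sub>R ((l * (l - 2 * m)) *\<^sub>R F p + (k * (k - 2 * m)) *\<^sub>R G p) = 0"
      by (simp add: 1 [OF p(1)])
    ultimately have "((l - k) * (l * (l - 2 * m))) *\<^sub>R F p = 0"
      by (auto simp: scaleR_add_right scaleR_left_diff_distrib left_diff_distrib add_eq_0_iff)
    then show ?thesis
      using p(2) lk by simp
  qed
  have eq': "p = c + G p + F p" if "p \<in> points M" for p
    using eq [OF that] by (simp add: add_ac)
  \<comment> \<open>Distinct roots of \<open>t (t - 2 m)\<close> cannot both be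
    \<open>2 m\<close>.\<close>
  have "l = 0 \<or> k = 0"
    using root [OF F G lk eq] root [OF G F lk [symmetric] eq'] lk by auto
  then show False
    using impossible [OF F G lk eq root [OF G F lk [symmetric] eq']]
      impossible [OF G F lk [symmetric] eq' root [OF F G lk eq]] by blast
qed

lemma finite_type_1_iff: "finite_type 1 M \<longleftrightarrow> (\<forall>p\<in>points M. f p = 1)"
proof
  assume f: "\<forall>p\<in>points M. f p = 1"
  show "finite_type 1 M"
    by (rule mean_curvature_1) (use f finite_type_1_if in force)+
qed (use finite_type_1_imp in blast)

lemma finite_type_2_iff: "finite_type 2 M \<longleftrightarrow> (\<exists>a. 0 < a \<and> a < 1 \<and> (\<forall>p\<in>points M. f p = a))"
proof
  assume type: "finite_type 2 M"
  then obtain a where a: "\<And>p. p \<in> points M \<Longrightarrow> f p = a"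
    using finite_type_2_const_mean_curvature by metis
  have "a \<noteq> 1"
    using finite_type_2_mean_curvature_neq_1 a type by blast
  then have "0 < a" "a < 1"
    using const_mean_curvature_bounds [OF a] by auto
  then show "\<exists>a. 0 < a \<and> a < 1 \<and> (\<forall>p\<in>points M. f p = a)"
    using a by blast
qed (use finite_type_2_if in blast)

end

theorem theorem5p8:
  fixes M :: "('m::finite, 'n::finite) atlas"
  assumes "connected_sphere_submanifold M"
    and "proper_biharmonic M"
  shows "(finite_type 1 M \<longleftrightarrow> (\<forall>p\<in>points M. mean_curvature M p = 1)) \<and>
     (finite_type 1 M \<longrightarrow>
       (\<exists>\<phi>\<^sub>0 \<phi>\<^sub>p. (\<forall>q\<in>points M. q = \<phi>\<^sub>0 + \<phi>\<^sub>p q) \<and>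
          eigenmap M (2 * real CARD('m)) \<phi>\<^sub>p \<and> norm \<phi>\<^sub>0 = 1 / sqrt 2)) \<and>
     (finite_type 2 M \<longleftrightarrow> (\<exists>f. 0 < f \<and> f < 1 \<and> (\<forall>p\<in>points M. mean_curvature M p = f))) \<and>
     (\<forall>f. finite_type 2 M \<and> (\<forall>p\<in>points M. mean_curvature M p = f) \<longrightarrow>
       (\<exists>\<phi>\<^sub>p \<phi>\<^sub>q. (\<forall>q\<in>points M. q = \<phi>\<^sub>p q + \<phi>\<^sub>q q) \<and>
          eigenmap M (real CARD('m) * (1 - f)) \<phi>\<^sub>p \<and>
          eigenmap M (real CARD('m) * (1 + f)) \<phi>\<^sub>q))"
proof -
  interpret proper_biharmonic_submanifold M "real CARD('m)"
    using assms by unfold_locales simp_all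
  have 1: "\<exists>\<phi>\<^sub>0 \<phi>\<^sub>p. (\<forall>q\<in>points M. q = \<phi>\<^sub>0 + \<phi>\<^sub>p q) \<and> eigenmap M (2 * real CARD('m)) \<phi>\<^sub>p \<and> norm \<phi>\<^sub>0 = 1 / sqrt 2"
    if type: "finite_type 1 M"
  proof -
    obtain \<phi>\<^sub>0 where "norm \<phi>\<^sub>0 = 1 / sqrt 2" "eigenmap M (2 * real CARD('m)) (\<lambda>p. p - \<phi>\<^sub>0)"
      using mean_curvature_1 finite_type_1_imp [OF type] by metis
    then show ?thesis
      by (intro exI [of _ \<phi>\<^sub>0] exI [of _ "\<lambda>p. p - \<phi>\<^sub>0"]) simp
  qed
  have 2: "\<exists>\<phi>\<^sub>p \<phi>\<^sub>q. (\<forall>q\<in>points M. q = \<phi>\<^sub>p q + \<phi>\<^sub>q q) \<and> eigenmap M (real CARD('m) * (1 - a)) \<phi>\<^sub>p \<and> eigenmap M (real CARD('m) * (1 + a)) \<phi>\<^sub>q"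
    if type: "finite_type 2 M" and a: "\<forall>p\<in>points M. mean_curvature M p = a" for a
  proof -
    \<comment> \<open>A point is needed to identify \<open>a\<close> with the constant provided by
      \<open>finite_type_2_iff\<close>.\<close>
    obtain p0 where "p0 \<in> points M"
      using not_minimal by metis
    then have "0 < a" "a < 1"
      using finite_type_2_iff type a by auto
    then show ?thesis
      using eigenmap_decomposition [of a 1] eigenmap_decomposition [of a "- 1"] ident_decomposition [of a] a
      by (intro exI [of _ "\<lambda>p. (1 / 2) *\<^sub>R p + (1 / (2 * a)) *\<^sub>R H p"]
          exI [of _ "\<lambda>p. (1 / 2) *\<^sub>R p + (- 1 / (2 * a)) *\<^sub>R H p"]) auto
  qed
  show ?thesis
    using finite_type_1_iff finite_type_2_iff 1 2 by blast
qed

end
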